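(* Let $\mathbb{k}$ be a field of characteristic $0$, let $n\ge 0$, and let $\alpha$ be a composition of $n$. Then the minimal polynomial of the element $w_0B_\alpha$ of $\mathbb{k}S_n$ is \[ \prod_{k\in\widetilde{n}_\alpha(\Sigma_n)}(x-k), \] the product ranging over the distinct elements of the set $\widetilde{n}_\alpha(\Sigma_n)$.
   Context: $S_n$ is the symmetric group of $[n]=\{1,\ldots,n\}$ with product $(\sigma\tau)(i)=\sigma(\tau(i))$; $\mathbb{k}S_n$ is its group algebra; $w_0\in S_n$ is given by $w_0(i)=n+1-i$. A composition of $n$ is a tuple $\alpha=(\alpha_1,\ldots,\alpha_k)$ of positive integers with sum $n$. For $w\in S_n$, $\operatorname{Des}w=\{i\in[n-1]: w(i)>w(i+1)\}$. Put $D(\alpha)=\{\alpha_1,\alpha_1+\alpha_2,\ldots,\alpha_1+\cdots+\alpha_{k-1}\}$ and $B_\alpha=\sum_{w\in S_n,\ \operatorname{Des}w\subseteq D(\alpha)}w$. A set composition of $[n]$ is a tuple $F=(F_1,\ldots,F_m)$ of nonempty pairwise disjoint sets with union $[n]$; $\ell(F)=m$; $\operatorname{type}F=(|F_1|,\ldots,|F_m|)$; $\Sigma_n$ is the set of all set compositions of $[n]$. $F\preceq G$ means every block of $F$ is contained in some block of $G$. $n_\alpha(F)=\#\{G\in\Sigma_n:F\preceq G,\ \operatorname{type}G=\alpha\}$, $\widetilde{n}_\alpha(F)=(-1)^{n-\ell(F)}n_\alpha(F)$, and $\widetilde{n}_\alpha(\Sigma_n)=\{\widetilde{n}_\alpha(F):F\in\Sigma_n\}$.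 *)

theory Defs
  imports
    "HOL-Computational_Algebra.Polynomial"
    "HOL-Algebra.Module"
    "HOL-Algebra.Sym_Groups"
    "HOL-Library.Disjoint_Sets"
begin

hide_const (open) Polynomial.smult

text \<open>
  The group algebra of \<open>G\<close> over \<open>'k\<close>: finitely supported functions on \<open>carrier G\<close>
  (extended by zero to the whole type) with the convolution product. The convolution
  ranges over the supports of the factors only, so that it is a finite sum
  for every \<open>G\<close>.
\<close>

definition group_algebra :: "('g, 'm) monoid_scheme \<Rightarrow> ('k::field, 'g \<Rightarrow> 'k) module" where
  "group_algebra G =
     \<lparr> carrier = {f. finite {x. f x \<noteq> 0} \<and> {x. f x \<noteq> 0} \<subseteq> carrier G},
       mult = (\<lambda>f g x. \<Sum>(u, v) \<in> {(u, v). f u \<noteq> 0 \<and> g v \<noteq> 0 \<and> u \<otimes>\<^bsub>G\<^esub> v = x}. f u * g v),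
       one = (\<lambda>x. if x = \<one>\<^bsub>G\<^esub> then 1 else 0),
       zero = (\<lambda>x. 0),
       add = (\<lambda>f g x. f x + g x),
       smult = (\<lambda>c f x. c * f x) \<rparr>"

definition basis_elem :: "'g \<Rightarrow> 'g \<Rightarrow> 'k::field" where
  "basis_elem w = (\<lambda>x. if x = w then 1 else 0)"

definition poly_eval :: "('k::field, 'a) module \<Rightarrow> 'k poly \<Rightarrow> 'a \<Rightarrow> 'a" where
  "poly_eval A p a = (\<Oplus>\<^bsub>A\<^esub>i\<in>{..degree p}. coeff p i \<odot>\<^bsub>A\<^esub> (a [^]\<^bsub>A\<^esub> i))"

definition is_minimal_polynomial :: "('k::field, 'a) module \<Rightarrow> 'a \<Rightarrow> 'k poly \<Rightarrow> bool" where
  "is_minimal_polynomial A a p \<longleftrightarrow>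
     lead_coeff p = 1 \<and> poly_eval A p a = \<zero>\<^bsub>A\<^esub> \<and>
     (\<forall>q. q \<noteq> 0 \<and> poly_eval A q a = \<zero>\<^bsub>A\<^esub> \<longrightarrow> degree p \<le> degree q)"

definition composition_of :: "nat \<Rightarrow> nat list \<Rightarrow> bool" where
  "composition_of n \<alpha> \<longleftrightarrow> (\<forall>a \<in> set \<alpha>. 0 < a) \<and> sum_list \<alpha> = n"

definition Des :: "nat \<Rightarrow> (nat \<Rightarrow> nat) \<Rightarrow> nat set" where
  "Des n w = {i \<in> {1..<n}. w i > w (i + 1)}"

definition partial_sums :: "nat list \<Rightarrow> nat set" where
  "partial_sums \<alpha> = (\<lambda>i. sum_list (take i \<alpha>)) ` {1..<length \<alpha>}"

definition w0 :: "nat \<Rightarrow> nat \<Rightarrow> nat" where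
  "w0 n = (\<lambda>i. if i \<in> {1..n} then n + 1 - i else i)"

definition B_elem :: "nat \<Rightarrow> nat list \<Rightarrow> (nat \<Rightarrow> nat) \<Rightarrow> 'k::field" where
  "B_elem n \<alpha> =
     (\<Oplus>\<^bsub>group_algebra (sym_group n)\<^esub>
        w\<in>{w \<in> carrier (sym_group n). Des n w \<subseteq> partial_sums \<alpha>}. basis_elem w)"

definition set_compositions :: "nat \<Rightarrow> nat set list set" where
  "set_compositions n =
     {F. {} \<notin> set F \<and> disjoint_family_on ((!) F) {..<length F} \<and> \<Union> (set F) = {1..n}}"

definition comp_type :: "nat set list \<Rightarrow> nat list" where
  "comp_type F = map card F"

definition refines_blocks :: "nat set list \<Rightarrow> nat set list \<Rightarrow> bool" (infix \<open>\<preceq>\<^sub>b\<close> 50) where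
  "F \<preceq>\<^sub>b G \<longleftrightarrow> (\<forall>X \<in> set F. \<exists>Y \<in> set G. X \<subseteq> Y)"

definition n_count :: "nat \<Rightarrow> nat list \<Rightarrow> nat set list \<Rightarrow> nat" where
  "n_count n \<alpha> F = card {G \<in> set_compositions n. F \<preceq>\<^sub>b G \<and> comp_type G = \<alpha>}"

definition n_tilde :: "nat \<Rightarrow> nat list \<Rightarrow> nat set list \<Rightarrow> int" where
  "n_tilde n \<alpha> F = (-1) ^ (n - length F) * int (n_count n \<alpha> F)"

end

theory Submission
  imports Defs
begin

text \<open>
  Faces (set compositions) form a monoid under \<open>face_mult\<close> and act on words, i.e. on permutations in
  one-line notation. By Bidigare's theorem, right multiplication by \<open>w\<^sub>0 B\<^sub>\<alpha>\<close> is the operator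
  \<open>C \<mapsto> \<Sum>\<^sub>G G \<cdot> rev C\<close>, \<open>G\<close> ranging over the faces of type \<open>\<alpha>\<close>; \<open>T\<close> denotes its transpose on
  functions.

  Composing \<open>T\<close> with the action of a face \<open>F\<close> gives \<open>n\<^sub>\<alpha>(F)\<close> times the reversed action of \<open>F\<close>, plus
  actions of faces \<open>F G\<close> on which \<open>n\<^sub>\<alpha>\<close> is strictly larger. Induction on \<open>n\<^sub>\<alpha>\<close> shows that \<open>T\<close> is
  annihilated by a product of distinct factors \<open>x \<plusminus> n\<^sub>\<alpha>(F)\<close>. On the other hand, Takeuchi's antipode
  formula writes reversal as \<open>\<Sum>\<^sub>G (-1)^(n - \<ell>(G)) G\<close>, which makes \<open>T\<close> triangular with respect to
  refinement, with diagonal entries \<open>(-1)^(n - \<ell>(F)) n\<^sub>\<alpha>(F)\<close>; hence a power of the asserted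
  polynomial annihilates \<open>T\<close>. Together these give that the asserted polynomial itself does.

  Every diagonal entry is a root of every annihilating polynomial: a product of Lie elements, one
  for each block of \<open>F\<close>, is fixed by \<open>F\<close> and killed by all faces that \<open>F\<close> does not refine.
\<close>

section \<open>Polynomials in a linear operator on functions\<close>

text \<open>Source and target may differ, so that a linear functional is covered too, as an operator
  into functions on \<open>unit\<close>.\<close>

definition lin_op :: "(('a \<Rightarrow> 'k::field) \<Rightarrow> ('b \<Rightarrow> 'k)) \<Rightarrow> bool" where
  "lin_op T \<longleftrightarrow> (\<forall>f g. T (\<lambda>x. f x + g x) = (\<lambda>x. T f x + T g x)) \<and>
     (\<forall>c f. T (\<lambda>x. c * f x) = (\<lambda>x. c * T f x))"

lemma lin_op_add: "lin_op T \<Longrightarrow> T (\<lambda>x. f x + g x) = (\<lambda>x. T f x + T g x)"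
  and lin_op_scale: "lin_op T \<Longrightarrow> T (\<lambda>x. c * f x) = (\<lambda>x. c * T f x)"
  by (auto simp: lin_op_def)

lemma lin_op_zero: "lin_op T \<Longrightarrow> T (\<lambda>x. 0) = (\<lambda>x. 0)"
  using lin_op_scale[of T 0 "\<lambda>_. 0"] by simp

lemma lin_op_sum:
  assumes "lin_op T"
  shows "T (\<lambda>x. \<Sum>i\<in>I. c i * f i x) = (\<lambda>x. \<Sum>i\<in>I. c i * T (f i) x)"
  by (induction I rule: infinite_finite_induct)
    (simp_all add: lin_op_zero[OF assms] lin_op_add[OF assms] lin_op_scale[OF assms])

text \<open>This is \<open>p(T)\<close> applied to \<open>f\<close>.\<close>

definition papp :: "(('a \<Rightarrow> 'k::field) \<Rightarrow> ('a \<Rightarrow> 'k)) \<Rightarrow> 'k poly \<Rightarrow> ('a \<Rightarrow> 'k) \<Rightarrow> 'a \<Rightarrow> 'k" where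
  "papp T p f = (\<lambda>x. \<Sum>i\<le>degree p. coeff p i * (T ^^ i) f x)"

lemma papp_atMost:
  assumes "degree p \<le> N"
  shows "papp T p f x = (\<Sum>i\<le>N. coeff p i * (T ^^ i) f x)"
  unfolding papp_def using assms
  by (intro sum.mono_neutral_left) (auto simp: coeff_eq_0)

lemma papp_0: "papp T 0 f = (\<lambda>x. 0)"
  by (simp add: papp_def)

lemma papp_pCons: "papp T (pCons c p) f = (\<lambda>x. c * f x + papp T p (T f) x)"
proof
  fix x
  have "papp T (pCons c p) f x = (\<Sum>i\<le>Suc (degree p). coeff (pCons c p) i * (T ^^ i) f x)"
    by (intro papp_atMost) (simp add: degree_pCons_le)
  also have "\<dots> = c * f x + (\<Sum>i\<le>degree p. coeff p i * (T ^^ Suc i) f x)"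
    by (subst sum.atMost_Suc_shift) simp
  finally show "papp T (pCons c p) f x = c * f x + papp T p (T f) x"
    by (simp add: papp_def funpow_swap1)
qed

lemma papp_linear: "papp T [:a, 1:] f = (\<lambda>x. a * f x + T f x)"
  by (simp add: papp_pCons papp_0)

lemma papp_add: "papp T (p + q) f = (\<lambda>x. papp T p f x + papp T q f x)"
proof
  fix x
  show "papp T (p + q) f x = papp T p f x + papp T q f x"
    using papp_atMost[of p "max (degree p) (degree q)" T f x]
      papp_atMost[of q "max (degree p) (degree q)" T f x]
      papp_atMost[OF degree_add_le_max[of p q], of T f x]
    by (simp add: sum.distrib algebra_simps)
qed

lemma papp_smult: "papp T (Polynomial.smult c p) f = (\<lambda>x. c * papp T p f x)"
proof
  fix x
  show "papp T (Polynomial.smult c p) f x = c * papp T p f x"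
    using papp_atMost[OF degree_smult_le[of c p], of T f x]
    by (simp add: papp_def sum_distrib_left mult.assoc)
qed

lemma lin_op_funpow:
  fixes T :: "('a \<Rightarrow> 'k::field) \<Rightarrow> 'a \<Rightarrow> 'k"
  shows "lin_op T \<Longrightarrow> lin_op (T ^^ i)"
  by (induction i) (simp_all add: lin_op_def)

lemma lin_op_papp:
  assumes "lin_op T"
  shows "lin_op (papp T p)"
  unfolding lin_op_def papp_def
  by (simp add: lin_op_add[OF lin_op_funpow[OF assms]] lin_op_scale[OF lin_op_funpow[OF assms]]
      sum.distrib sum_distrib_left algebra_simps)

lemma papp_commute:
  assumes "lin_op T"
  shows "papp T p (T f) = T (papp T p f)"
  unfolding papp_def by (simp add: lin_op_sum[OF assms] funpow_swap1)

lemma papp_mult: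
  assumes "lin_op T"
  shows "papp T (p * q) f = papp T p (papp T q f)"
proof (induction p arbitrary: f)
  case 0
  show ?case by (simp add: papp_0)
next
  case (pCons a p)
  show ?case
    by (simp add: papp_add papp_smult papp_pCons pCons.IH papp_commute[OF assms])
qed

lemma papp_eigen:
  assumes "lin_op T" "T f = (\<lambda>x. k * f x)"
  shows "papp T q f = (\<lambda>x. poly q k * f x)"
proof (induction q)
  case 0
  show ?case by (simp add: papp_0)
next
  case (pCons a p)
  show ?case
    by (simp add: papp_pCons assms(2) lin_op_scale[OF lin_op_papp[OF assms(1)]] pCons.IH algebra_simps)
qed

lemma papp_zero: "lin_op T \<Longrightarrow> papp T p (\<lambda>x. 0) = (\<lambda>x. 0)"
  by (rule lin_op_zero[OF lin_op_papp])

lemma papp_dvd_zero: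
  assumes "lin_op T" "p dvd q" "papp T p f = (\<lambda>x. 0)"
  shows "papp T q f = (\<lambda>x. 0)"
  using assms by (metis dvdE mult.commute papp_mult papp_zero)

text \<open>If \<open>g\<close> is what the other factors make of \<open>f\<close>, then
  \<open>T g = k g\<close>, hence \<open>q(T) g = q(k) g\<close>. Since \<open>q(T)\<close> commutes
  with those factors and kills \<open>f\<close>, it kills \<open>g\<close>; as \<open>q(k)\<close>
  is nonzero, \<open>g = 0\<close>.\<close>

lemma papp_drop_factors:
  fixes T :: "('a \<Rightarrow> 'k::field) \<Rightarrow> 'a \<Rightarrow> 'k"
  assumes T: "lin_op T" and q: "papp T q f = (\<lambda>x. 0)"
    and R: "finite R" "\<And>k. k \<in> R \<Longrightarrow> poly q k \<noteq> 0"
    and p: "papp T ((\<Prod>k\<in>R. [:- k, 1:]) * p) f = (\<lambda>x. 0)"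
  shows "papp T p f = (\<lambda>x. 0)"
  using R p
proof (induction R rule: finite_induct)
  case empty
  then show ?case by simp
next
  case (insert k R)
  define g where "g = papp T ((\<Prod>k\<in>R. [:- k, 1:]) * p) f"
  have "papp T [:- k, 1:] g = (\<lambda>x. 0)"
    unfolding g_def papp_mult[OF T, symmetric] mult.assoc[symmetric]
    using insert.prems(2) by (simp only: prod.insert[OF insert.hyps])
  then have "T g = (\<lambda>x. k * g x)"
    by (simp add: papp_linear fun_eq_iff)
  then have "papp T q g = (\<lambda>x. poly q k * g x)"
    by (rule papp_eigen[OF T])
  moreover have "papp T q g = (\<lambda>x. 0)"
    unfolding g_def papp_mult[OF T, symmetric]
    by (subst mult.commute) (simp add: papp_mult[OF T] q papp_zero[OF T])
  ultimately have "g = (\<lambda>x. 0)"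
    using insert.prems(1)[of k] by (simp add: fun_eq_iff)
  then show ?case
    using insert by (simp add: g_def)
qed

section \<open>The face monoid and its action on words\<close>

text \<open>The action of a face on a chamber: a stable sort of the letters by block.\<close>

definition face_act :: "nat set list \<Rightarrow> nat list \<Rightarrow> nat list" where
  "face_act F C = concat (map (\<lambda>S. filter (\<lambda>x. x \<in> S) C) F)"

text \<open>The Tits product.\<close>

definition face_mult :: "nat set list \<Rightarrow> nat set list \<Rightarrow> nat set list" where
  "face_mult F G = concat (map (\<lambda>S. filter (\<lambda>R. R \<noteq> {}) (map (\<lambda>R. S \<inter> R) G)) F)"

text \<open>The ground set is arbitrary because splitting off the first block leaves a set
  composition of its complement. Disjointness is put as \<open>sorted_wrt\<close> to suit induction
  on lists.\<close>

definition faces :: "nat set \<Rightarrow> nat set list set" where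
  "faces A = {F. {} \<notin> set F \<and> sorted_wrt disjnt F \<and> \<Union> (set F) = A}"

lemma face_act_Nil [simp]: "face_act [] C = []"
  and face_act_Cons [simp]: "face_act (S # F) C = filter (\<lambda>x. x \<in> S) C @ face_act F C"
  by (simp_all add: face_act_def)

text \<open>Inside a block \<open>S\<close> of \<open>F\<close>, the letters of \<open>G C\<close>
  come sorted by the sets \<open>S \<inter> R\<close>, with \<open>R\<close> in the order of
  \<open>G\<close>; this is how the Tits product orders its blocks.\<close>

lemma face_act_face_act: "face_act F (face_act G C) = face_act (face_mult F G) C"
proof -
  have "filter (\<lambda>x. x \<in> S) (face_act G C) = face_act (filter (\<lambda>R. R \<noteq> {}) (map (\<lambda>R. S \<inter> R) G)) C" for S
    by (induction G) (auto simp: conj_commute filter_empty_conv intro!: filter_cong)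
  moreover have "face_act (F1 @ F2) C = face_act F1 C @ face_act F2 C" for F1 F2
    by (simp add: face_act_def)
  ultimately show ?thesis
    by (induction F) (simp_all add: face_mult_def)
qed

text \<open>Lets a reversal be moved past a face, at the cost of reversing the order of its
  blocks.\<close>

lemma rev_face_act: "rev (face_act F C) = face_act (rev F) (rev C)"
  by (simp add: face_act_def rev_concat rev_map rev_filter comp_def)

lemma face_act_single: "set C \<subseteq> A \<Longrightarrow> face_act [A] C = C"
  by (auto simp: filter_id_conv)

lemma set_compositions_eq_faces: "set_compositions n = faces {1..n}"
proof -
  have "disjoint_family_on ((!) F) {..<length F} \<longleftrightarrow> sorted_wrt disjnt F" for F :: "nat set list"
  proof
    assume "sorted_wrt disjnt F"
    then have lt: "F ! i \<inter> F ! j = {}" if "i < j" "j < length F" for i j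
      using that by (simp add: sorted_wrt_iff_nth_less disjnt_def)
    show "disjoint_family_on ((!) F) {..<length F}"
      unfolding disjoint_family_on_def
    proof (intro ballI impI)
      fix i j assume "i \<in> {..<length F}" "j \<in> {..<length F}" "i \<noteq> j"
      then show "F ! i \<inter> F ! j = {}"
        using lt[of i j] lt[of j i] by (cases "i < j") (auto simp: Int_commute)
    qed
  qed (auto simp: disjoint_family_on_def sorted_wrt_iff_nth_less disjnt_def)
  then show ?thesis
    by (simp add: set_compositions_def faces_def)
qed

lemma faces_distinct: "F \<in> faces A \<Longrightarrow> distinct F"
  unfolding faces_def
proof safe
  assume "{} \<notin> set F" "sorted_wrt disjnt F"
  then show "distinct F" by (induction F) (auto simp: disjnt_def)
qed

lemma finite_faces:
  assumes "finite A"
  shows "finite (faces A)"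
proof (rule finite_subset)
  show "faces A \<subseteq> {F. set F \<subseteq> Pow A \<and> distinct F}"
    using faces_distinct by (auto simp: faces_def)
  show "finite {F. set F \<subseteq> Pow A \<and> distinct F}"
    using assms by (simp add: finite_subset_distinct)
qed

lemma rev_in_faces: "rev F \<in> faces A \<longleftrightarrow> F \<in> faces A"
proof -
  have "(\<lambda>S R. disjnt R S) = (disjnt :: nat set \<Rightarrow> _)"
    by (auto simp: fun_eq_iff disjnt_iff)
  then show ?thesis
    by (simp add: faces_def sorted_wrt_rev)
qed

lemma faces_blocks_disjoint:
  assumes "F \<in> faces A" "S \<in> set F" "R \<in> set F" "S \<noteq> R"
  shows "S \<inter> R = {}"
proof -
  have "sorted_wrt disjnt F \<Longrightarrow> S \<in> set F \<Longrightarrow> R \<in> set F \<Longrightarrow> S \<noteq> R \<Longrightarrow> disjnt S R" for F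
    by (induction F) (auto intro: disjnt_sym)
  then have "disjnt S R"
    using assms unfolding faces_def by blast
  then show ?thesis by (simp add: disjnt_def)
qed

lemma set_face_mult: "set (face_mult F G) = {S \<inter> R |S R. S \<in> set F \<and> R \<in> set G \<and> S \<inter> R \<noteq> {}}"
  by (auto simp: face_mult_def)

lemma face_mult_in_faces:
  assumes "F \<in> faces A" "G \<in> faces A"
  shows "face_mult F G \<in> faces A"
proof -
  have G: "sorted_wrt disjnt (filter (\<lambda>R. R \<noteq> {}) (map (\<lambda>R. S \<inter> R) G))" for S
    using assms(2) unfolding faces_def
    by (intro sorted_wrt_filter)
      (auto simp: sorted_wrt_map disjnt_def elim!: sorted_wrt_mono_rel[rotated])
  have "sorted_wrt disjnt F \<Longrightarrow> sorted_wrt disjnt (face_mult F G)" for F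
    using G by (induction F) (auto simp: face_mult_def sorted_wrt_append disjnt_def)
  moreover have "\<Union> (set (face_mult F G)) = \<Union> (set F) \<inter> \<Union> (set G)"
    unfolding set_face_mult by blast
  ultimately show ?thesis
    using assms by (auto simp: faces_def set_face_mult)
qed

text \<open>A block \<open>S\<close> of \<open>F\<close> lies in one block of \<open>G\<close> and
  misses the others, so \<open>S\<close> itself is its only nonempty intersection with blocks of
  \<open>G\<close>.\<close>

lemma face_mult_absorb:
  assumes "F \<in> faces A" "G \<in> faces A" "F \<preceq>\<^sub>b G"
  shows "face_mult F G = F"
proof -
  have "filter (\<lambda>R. R \<noteq> {}) (map (\<lambda>R. S \<inter> R) G) = [S]" if S: "S \<in> set F" for S
  proof -
    obtain Y where Y: "Y \<in> set G" "S \<subseteq> Y"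
      using assms(3) S by (auto simp: refines_blocks_def)
    then obtain G1 G2 where G: "G = G1 @ Y # G2"
      by (meson split_list)
    have "S \<noteq> {}" using S assms(1) by (auto simp: faces_def)
    moreover have "\<forall>R\<in>set G1 \<union> set G2. Y \<inter> R = {}"
      using assms(2) by (auto simp: G faces_def sorted_wrt_append disjnt_def)
    then have "\<forall>R\<in>set G1 \<union> set G2. S \<inter> R = {}"
      using Y(2) by blast
    ultimately show ?thesis
      using Y(2) by (auto simp: G Int_absorb2 filter_empty_conv)
  qed
  then have "face_mult F G = concat (map (\<lambda>S. [S]) F)"
    unfolding face_mult_def by (metis (no_types, lifting) map_eq_conv)
  then show ?thesis by simp
qed

lemma refines_trans: "F \<preceq>\<^sub>b G \<Longrightarrow> G \<preceq>\<^sub>b H \<Longrightarrow> F \<preceq>\<^sub>b H"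
  unfolding refines_blocks_def by (meson subset_trans)

lemma refines_refl: "F \<preceq>\<^sub>b F"
  unfolding refines_blocks_def by blast

lemma refines_rev: "F \<preceq>\<^sub>b rev G \<longleftrightarrow> F \<preceq>\<^sub>b G"
  by (simp add: refines_blocks_def)

lemma face_mult_refines: "face_mult F G \<preceq>\<^sub>b F" "face_mult F G \<preceq>\<^sub>b G"
  by (auto simp: refines_blocks_def set_face_mult)

definition words :: "nat set \<Rightarrow> nat list set" where
  "words A = {C. distinct C \<and> set C = A}"

lemma rev_in_words: "rev C \<in> words A \<longleftrightarrow> C \<in> words A"
  by (simp add: words_def)

lemma set_face_act: "set (face_act F C) = \<Union> (set F) \<inter> set C"
  by (induction F) auto

lemma face_act_in_words:
  assumes "F \<in> faces A" "C \<in> words A"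
  shows "face_act F C \<in> words A"
proof -
  have "sorted_wrt disjnt F \<Longrightarrow> distinct (face_act F C)" for F
    using assms(2) by (induction F) (auto simp: words_def set_face_act disjnt_def)
  then show ?thesis using assms by (auto simp: words_def faces_def set_face_act)
qed

lemma sum_card_faces:
  assumes "finite A" "F \<in> faces A"
  shows "sum_list (map card F) = card A"
proof -
  have "sorted_wrt disjnt F \<Longrightarrow> finite (\<Union> (set F)) \<Longrightarrow> sum_list (map card F) = card (\<Union> (set F))"
  proof (induction F)
    case (Cons S F)
    then have "S \<inter> \<Union> (set F) = {}" by (auto simp: disjnt_def)
    with Cons show ?case by (simp add: card_Un_disjoint)
  qed simp
  with assms show ?thesis by (simp add: faces_def)
qed

lemma length_faces_le:
  assumes "finite A" "F \<in> faces A"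
  shows "length F \<le> card A"
proof -
  have "{} \<notin> set F \<Longrightarrow> finite (\<Union> (set F)) \<Longrightarrow> length F \<le> sum_list (map card F)"
  proof (induction F)
    case (Cons S F)
    then have "card S > 0" by (auto simp: card_gt_0_iff)
    with Cons show ?case by simp
  qed simp
  with assms sum_card_faces[OF assms] show ?thesis by (simp add: faces_def)
qed

section \<open>Reversal of words and Lie elements\<close>

lemma faces_empty: "faces {} = {[]}"
proof -
  have "F = []" if "F \<in> faces {}" for F
    using that by (cases F) (auto simp: faces_def)
  then show ?thesis by (auto simp: faces_def)
qed

lemma Cons_in_faces:
  "S # F \<in> faces B \<longleftrightarrow> S \<noteq> {} \<and> S \<subseteq> B \<and> F \<in> faces (B - S)"
  by (auto simp: faces_def disjnt_def)

lemma sum_faces_first_block: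
  assumes "finite B" "B \<noteq> {}"
  shows "(\<Sum>F\<in>faces B. g F) = (\<Sum>S\<in>Pow B - {{}}. \<Sum>F\<in>faces (B - S). g (S # F))"
proof -
  have "(\<Sum>S\<in>Pow B - {{}}. \<Sum>F\<in>faces (B - S). g (S # F)) =
    (\<Sum>(S, F)\<in>(SIGMA S:Pow B - {{}}. faces (B - S)). g (S # F))"
    using assms by (intro sum.Sigma) (auto intro: finite_faces)
  also have "\<dots> = (\<Sum>F\<in>faces B. g F)"
  proof (rule sum.reindex_bij_witness[of _ "\<lambda>F. (hd F, tl F)" "\<lambda>(S, F). S # F"])
    fix F assume F: "F \<in> faces B"
    with assms(2) have "F \<noteq> []" by (auto simp: faces_def)
    then obtain S F' where "F = S # F'" by (cases F) auto
    with F show "(case (hd F, tl F) of (S, F) \<Rightarrow> S # F) = F"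
      "(hd F, tl F) \<in> (SIGMA S:Pow B - {{}}. faces (B - S))"
      by (auto simp: Cons_in_faces)
  qed (auto simp: Cons_in_faces)
  finally show ?thesis by simp
qed

text \<open>A sign-reversing involution: toggle in \<open>S\<close> the last letter \<open>c\<close>
  of \<open>C\<close> that lies in \<open>B\<close>. It ends the first factor or begins the reversed
  second one, so the word stays the same while the sign changes.\<close>

lemma alternating_sum_split_word:
  fixes f :: "nat list \<Rightarrow> 'k::field"
  assumes "finite B" "B \<noteq> {}" "distinct C" "B \<subseteq> set C"
  shows "(\<Sum>S\<in>Pow B. (-1) ^ card S *
    f (filter (\<lambda>x. x \<in> S) C @ rev (filter (\<lambda>x. x \<in> B - S) C))) = 0"
proof -
  obtain C1 c C2 where C: "C = C1 @ c # C2" "c \<in> B" "\<forall>z\<in>set C2. z \<notin> B"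
    using split_list_last_prop[of C "\<lambda>x. x \<in> B"] assms by blast
  define B' where "B' = B - {c}"
  have B: "B = insert c B'" "c \<notin> B'" "finite B'" using C assms by (auto simp: B'_def)
  have c: "c \<notin> set C1" "c \<notin> set C2" using assms(3) by (auto simp: C)
  let ?h = "\<lambda>S. (-1) ^ card S * f (filter (\<lambda>x. x \<in> S) C @ rev (filter (\<lambda>x. x \<in> B - S) C))"
  have cancel: "?h (insert c S) = - ?h S" if "S \<in> Pow B'" for S
  proof -
    have S: "S \<subseteq> B'" "c \<notin> S" "finite S"
      using that B finite_subset by auto
    have 1: "filter (\<lambda>x. x \<in> S) C2 = []" "filter (\<lambda>x. x \<in> insert c S) C2 = []"
      "filter (\<lambda>x. x \<in> B - S) C2 = []" "filter (\<lambda>x. x \<in> B - insert c S) C2 = []"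
      using C(2,3) S B by (auto simp: filter_empty_conv)
    have 2: "filter (\<lambda>x. x \<in> insert c S) C1 = filter (\<lambda>x. x \<in> S) C1"
      "filter (\<lambda>x. x \<in> B - insert c S) C1 = filter (\<lambda>x. x \<in> B - S) C1"
      using c by (auto intro!: filter_cong)
    have "filter (\<lambda>x. x \<in> insert c S) C = filter (\<lambda>x. x \<in> S) C @ [c]"
      unfolding C(1) using 1 2 S(2) by simp
    moreover have "filter (\<lambda>x. x \<in> B - S) C = filter (\<lambda>x. x \<in> B - insert c S) C @ [c]"
      unfolding C(1) using 1 2 S(2) C(2) by simp
    ultimately show ?thesis using S by simp
  qed
  have "(\<Sum>S\<in>Pow B. ?h S) = (\<Sum>S\<in>Pow B'. ?h S) + (\<Sum>S\<in>insert c ` Pow B'. ?h S)"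
    unfolding B(1) Pow_insert using B by (intro sum.union_disjoint) auto
  also have "(\<Sum>S\<in>insert c ` Pow B'. ?h S) = (\<Sum>S\<in>Pow B'. ?h (insert c S))"
  proof (rule sum.reindex_cong[OF _ refl refl])
    show "inj_on (insert c) (Pow B')"
    proof (rule inj_onI)
      fix X Y assume "X \<in> Pow B'" "Y \<in> Pow B'" "insert c X = insert c Y"
      then show "X = Y" using B(2) insert_ident[of c X Y] by blast
    qed
  qed
  also have "\<dots> = - (\<Sum>S\<in>Pow B'. ?h S)"
    using cancel by (simp add: sum_negf)
  finally show ?thesis by simp
qed

text \<open>Reversal of words is the antipode of the shuffle/concatenation Hopf algebra; this is
  Takeuchi's formula for it.\<close>

lemma reverse_filter_as_sum_of_faces:
  fixes f :: "nat list \<Rightarrow> 'k::field"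
  assumes "finite B" "distinct C" "B \<subseteq> set C"
  shows "(\<Sum>F\<in>faces B. (-1) ^ (card B + length F) * f (face_act F C)) =
    f (rev (filter (\<lambda>x. x \<in> B) C))"
  using assms(1,3)
proof (induction "card B" arbitrary: B f rule: less_induct)
  case less
  show ?case
  proof (cases "B = {}")
    case True
    then show ?thesis by (simp add: faces_empty)
  next
    case False
    let ?h = "\<lambda>S. (-1) ^ card S * f (filter (\<lambda>x. x \<in> S) C @ rev (filter (\<lambda>x. x \<in> B - S) C))"
    \<comment> \<open>Split off the first block \<open>S\<close>. The rest is a face of the smaller
      set \<open>B - S\<close>, where the induction hypothesis turns the signed sum into a reversal;
      the additional block gives the minus sign.\<close>
    have "(\<Sum>F\<in>faces B. (-1) ^ (card B + length F) * f (face_act F C)) =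
      (\<Sum>S\<in>Pow B - {{}}. \<Sum>F\<in>faces (B - S).
        (-1) ^ (card B + length (S # F)) * f (face_act (S # F) C))"
      using less.prems False by (subst sum_faces_first_block) auto
    also have "\<dots> = (\<Sum>S\<in>Pow B - {{}}. - ?h S)"
    proof (rule sum.cong)
      fix S assume S: "S \<in> Pow B - {{}}"
      then have fin: "finite S" using less.prems finite_subset by auto
      have card: "card B = card S + card (B - S)"
        using S fin less.prems by (simp add: card_Diff_subset card_mono)
      have "card S > 0" using S fin by (auto simp: card_gt_0_iff)
      then have "(\<Sum>F\<in>faces (B - S). (-1) ^ (card (B - S) + length F) *
          f (filter (\<lambda>x. x \<in> S) C @ face_act F C)) =
        f (filter (\<lambda>x. x \<in> S) C @ rev (filter (\<lambda>x. x \<in> B - S) C))"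
        using less.prems card by (intro less.hyps) auto
      then show "(\<Sum>F\<in>faces (B - S). (-1) ^ (card B + length (S # F)) * f (face_act (S # F) C)) = - ?h S"
        by (simp add: card power_add sum_negf mult.assoc flip: sum_distrib_left)
    qed simp
    \<comment> \<open>With the term for \<open>S = {}\<close> included the sum would vanish; that
      missing term is the reversed word.\<close>
    also have "\<dots> = - ((\<Sum>S\<in>Pow B. ?h S) - ?h {})"
      using less.prems by (simp add: sum_negf sum_diff1)
    also have "\<dots> = f (rev (filter (\<lambda>x. x \<in> B) C))"
      using alternating_sum_split_word[OF less.prems(1) False assms(2) less.prems(2), of f] by simp
    finally show ?thesis .
  qed
qed

lemma reverse_as_sum_of_faces:
  fixes f :: "nat list \<Rightarrow> 'k::field"
  assumes "finite A" "C \<in> words A"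
  shows "f (rev C) = (\<Sum>F\<in>faces A. (-1) ^ (card A + length F) * f (face_act F C))"
proof -
  have "filter (\<lambda>x. x \<in> A) C = C" using assms by (simp add: words_def filter_id_conv)
  then show ?thesis
    using reverse_filter_as_sum_of_faces[OF assms(1), of C f] assms by (simp add: words_def)
qed

section \<open>Lie elements and their products over the blocks of a face\<close>

text \<open>\<open>lie [x\<^sub>m, \<dots>, x\<^sub>1] f\<close> is the linear extension of \<open>f\<close> evaluated at
  \<open>[\<dots>[[x\<^sub>1, x\<^sub>2], x\<^sub>3], \<dots>, x\<^sub>m]\<close>; the value at the empty list is irrelevant.\<close>

fun lie :: "nat list \<Rightarrow> (nat list \<Rightarrow> 'k::field) \<Rightarrow> 'k" where
  "lie [] f = f []"
| "lie [x] f = f [x]"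
| "lie (x # y # xs) f = lie (y # xs) (\<lambda>w. f (w @ [x])) - lie (y # xs) (\<lambda>w. f (x # w))"

text \<open>The product, in the free associative algebra, of the Lie elements given by the lists,
  again encoded as a functional.\<close>

fun lie_prod :: "nat list list \<Rightarrow> (nat list \<Rightarrow> 'k::field) \<Rightarrow> 'k" where
  "lie_prod [] f = f []"
| "lie_prod (xs # Xs) f = lie xs (\<lambda>w. lie_prod Xs (\<lambda>v. f (w @ v)))"

text \<open>Only rearrangements of \<open>xs\<close> occur when the bracket is expanded.\<close>

lemma lie_cong:
  assumes "\<And>w. mset w = mset xs \<Longrightarrow> f w = g w"
  shows "lie xs f = lie xs g"
  using assms
proof (induction xs f arbitrary: g rule: lie.induct)
  case (3 x y xs f)
  show ?case
    using "3.IH"(1)[of "\<lambda>w. g (w @ [x])"] "3.IH"(2)[of "\<lambda>w. g (x # w)"] "3.prems"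
    by simp
qed auto

lemma lie_prod_cong:
  assumes "\<And>w. mset w = mset (concat Xs) \<Longrightarrow> f w = g w"
  shows "lie_prod Xs f = lie_prod Xs g"
  using assms
proof (induction Xs arbitrary: f g)
  case (Cons xs Xs)
  have "lie_prod Xs (\<lambda>v. f (w @ v)) = lie_prod Xs (\<lambda>v. g (w @ v))" if "mset w = mset xs" for w
    using that Cons.prems by (intro Cons.IH) simp
  then show ?case by (auto intro: lie_cong)
qed simp

lemma lie_add: "lie xs (\<lambda>w. f w + g w) = lie xs f + lie xs g"
proof (induction xs arbitrary: f g)
  case (Cons x xs)
  then show ?case by (cases xs) simp_all
qed simp

lemma lie_scale: "lie xs (\<lambda>w. c * f w) = c * lie xs f"
proof (induction xs arbitrary: f)
  case (Cons x xs)
  then show ?case by (cases xs) (simp_all add: right_diff_distrib)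
qed simp

lemma lin_op_lie_prod: "lin_op (\<lambda>f (_ :: unit). lie_prod Xs f)"
  by (induction Xs) (auto simp: lin_op_def fun_eq_iff lie_add lie_scale)

lemma lie_zero: "lie xs (\<lambda>w. 0) = 0"
  using lie_scale[of xs 0 "\<lambda>_. 0"] by simp

lemma lie_prod_zero: "lie_prod Xs (\<lambda>w. 0) = 0"
  by (induction Xs) (simp_all add: lie_zero)

text \<open>Induction on the bracket \<open>[P, x]\<close>. If the letters of \<open>P\<close> are
  spread over several blocks, both terms vanish by induction. Otherwise they lie in one block
  without \<open>x\<close>, so \<open>G\<close> cannot tell \<open>P x\<close> from
  \<open>x P\<close>, and the terms cancel. The arbitrary \<open>h\<close> lets the letter
  \<open>x\<close> be absorbed into the context \<open>u\<close> or \<open>v\<close>.\<close>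

lemma lie_face_zero:
  assumes G: "G \<in> faces A" and "set xs \<subseteq> A" "xs \<noteq> []" "\<not> (\<exists>S\<in>set G. set xs \<subseteq> S)"
  shows "lie xs (\<lambda>w. h (\<lambda>u v. face_act G (u @ w @ v))) = 0"
  using assms(2-)
proof (induction xs arbitrary: h)
  case (Cons x xs)
  show ?case
  proof (cases xs)
    case Nil
    then show ?thesis using Cons.prems G by (auto simp: faces_def)
  next
    case (Cons y ys)
    note xs = this
    have eq: "lie (x # xs) (\<lambda>w. h (\<lambda>u v. face_act G (u @ w @ v))) =
      lie xs (\<lambda>w. h (\<lambda>u v. face_act G (u @ w @ ([x] @ v)))) -
      lie xs (\<lambda>w. h (\<lambda>u v. face_act G ((u @ [x]) @ w @ v)))"
      by (simp add: xs)
    show ?thesis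
    proof (cases "\<exists>S\<in>set G. set xs \<subseteq> S")
      case False
      have "lie xs (\<lambda>w. h (\<lambda>u v. face_act G (u @ w @ ([x] @ v)))) = 0"
        using Cons.IH[of "\<lambda>k. h (\<lambda>u v. k u ([x] @ v))"] False Cons.prems xs by simp
      moreover have "lie xs (\<lambda>w. h (\<lambda>u v. face_act G ((u @ [x]) @ w @ v))) = 0"
        using Cons.IH[of "\<lambda>k. h (\<lambda>u v. k (u @ [x]) v)"] False Cons.prems xs by simp
      ultimately show ?thesis using eq by simp
    next
      case True
      then obtain S where S: "S \<in> set G" "set xs \<subseteq> S" by blast
      then have "x \<notin> S" using Cons.prems by auto
      have "face_act G (u @ w @ ([x] @ v)) = face_act G ((u @ [x]) @ w @ v)"
        if "mset w = mset xs" for u v w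
      proof -
        have w: "set w \<subseteq> S" using S that by (metis set_mset_mset)
        \<comment> \<open>A block of \<open>G\<close> either contains \<open>x\<close>, and then no
          letter of \<open>w\<close>, or does not contain \<open>x\<close>.\<close>
        have "filter (\<lambda>z. z \<in> R) (w @ [x]) = filter (\<lambda>z. z \<in> R) (x # w)" if "R \<in> set G" for R
        proof (cases "x \<in> R")
          case True
          then have "R \<inter> S = {}"
            using faces_blocks_disjoint[OF G that S(1)] \<open>x \<notin> S\<close> by auto
          then have "filter (\<lambda>z. z \<in> R) w = []"
            using w by (auto simp: filter_empty_conv)
          then show ?thesis by simp
        qed simp
        then have "filter (\<lambda>z. z \<in> R) (u @ w @ ([x] @ v)) = filter (\<lambda>z. z \<in> R) ((u @ [x]) @ w @ v)"
          if "R \<in> set G" for R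
          using that by (metis append_Cons append_assoc append_Nil filter_append)
        then show ?thesis
          unfolding face_act_def by (intro arg_cong[where f = concat] map_cong) auto
      qed
      then show ?thesis
        unfolding eq by (auto intro!: lie_cong arg_cong[where f = h] ext)
    qed
  qed
qed simp

text \<open>Some factor has its letters in no single block of \<open>G\<close>, and that factor
  already gives zero; the prefix \<open>u\<close> collects the words of the factors before
  it.\<close>

lemma lie_prod_face_zero:
  assumes G: "G \<in> faces A" and "\<Union> (set (map set Xs)) \<subseteq> A" "[] \<notin> set Xs" "\<not> map set Xs \<preceq>\<^sub>b G"
  shows "lie_prod Xs (\<lambda>v. f (face_act G (u @ v))) = 0"
  using assms(2-)
proof (induction Xs arbitrary: u)
  case Nil
  then show ?case by (simp add: refines_blocks_def)
next
  case (Cons xs Xs)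
  show ?case
  proof (cases "\<exists>S\<in>set G. set xs \<subseteq> S")
    case True
    then have "\<not> map set Xs \<preceq>\<^sub>b G"
      using Cons.prems by (auto simp: refines_blocks_def)
    then have "lie_prod Xs (\<lambda>v. f (face_act G ((u @ w) @ v))) = 0" for w
      using Cons.prems by (intro Cons.IH) auto
    then show ?thesis by (simp add: lie_zero)
  next
    case False
    then show ?thesis
      using lie_face_zero[OF G, of xs "\<lambda>k. lie_prod Xs (\<lambda>v. f (k u v))"] Cons.prems by auto
  qed
qed

text \<open>Reversal is an anti-automorphism, so each bracket changes sign. There is one bracket
  fewer than letters; \<open>+ 1\<close> has the same parity as \<open>- 1\<close>.\<close>

lemma lie_rev:
  "xs \<noteq> [] \<Longrightarrow> lie xs (\<lambda>w. f (rev w)) = (-1) ^ (length xs + 1) * lie xs f"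
proof (induction xs arbitrary: f)
  case (Cons x xs)
  show ?case
  proof (cases xs)
    case (Cons y ys)
    have "lie (x # xs) (\<lambda>w. f (rev w)) =
      lie xs (\<lambda>w. f (x # rev w)) - lie xs (\<lambda>w. f (rev w @ [x]))"
      by (simp add: Cons)
    also have "\<dots> = (-1) ^ (length xs + 1) * lie xs (\<lambda>w. f (x # w)) -
        (-1) ^ (length xs + 1) * lie xs (\<lambda>w. f (w @ [x]))"
      using Cons.IH[of "\<lambda>w. f (x # w)"] Cons.IH[of "\<lambda>w. f (w @ [x])"] Cons by simp
    finally show ?thesis by (simp add: Cons algebra_simps)
  qed simp
qed simp

lemma face_act_append_disjoint:
  assumes "\<Union> (set F) \<inter> set w = {}"
  shows "face_act F (w @ v) = face_act F v" "face_act F (v @ w) = face_act F v"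
proof -
  have "filter (\<lambda>x. x \<in> S) w = []" if "S \<in> set F" for S
    using assms that by (auto simp: filter_empty_conv)
  then show "face_act F (w @ v) = face_act F v" "face_act F (v @ w) = face_act F v"
    by (auto simp: face_act_def intro!: arg_cong[where f = concat] map_cong)
qed

text \<open>Each word in the product already lists the letters of the blocks one block after the
  other, so the face fixes it.\<close>

lemma lie_prod_own_face:
  assumes "sorted_wrt disjnt (map set Xs)"
  shows "lie_prod Xs (\<lambda>v. f (face_act (map set Xs) v)) = lie_prod Xs f"
  using assms
proof (induction Xs arbitrary: f)
  case (Cons xs Xs)
  have disj: "set xs \<inter> \<Union> (set (map set Xs)) = {}"
    using Cons.prems by (auto simp: disjnt_def)
  have "lie_prod Xs (\<lambda>v. f (face_act (map set (xs # Xs)) (w @ v))) =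
      lie_prod Xs (\<lambda>v. f (w @ v))" if w: "mset w = mset xs" for w
  proof -
    have sw: "set w = set xs" using w by (metis set_mset_mset)
    have "lie_prod Xs (\<lambda>v. f (face_act (map set (xs # Xs)) (w @ v))) =
      lie_prod Xs (\<lambda>v. f (w @ face_act (map set Xs) v))"
    proof (rule lie_prod_cong)
      fix v assume "mset v = mset (concat Xs)"
      then have "set v = set (concat Xs)" by (metis set_mset_mset)
      then have "filter (\<lambda>x. x \<in> set xs) v = []"
        using disj by (auto simp: filter_empty_conv)
      then show "f (face_act (map set (xs # Xs)) (w @ v)) = f (w @ face_act (map set Xs) v)"
        using disj sw by (simp add: face_act_append_disjoint Int_commute filter_id_conv)
    qed
    also have "\<dots> = lie_prod Xs (\<lambda>v. f (w @ v))"
      using Cons.prems by (intro Cons.IH[of "\<lambda>v. f (w @ v)"]) simp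
    finally show ?thesis .
  qed
  then show ?case by (auto intro: lie_cong)
qed simp

text \<open>Reversal reverses each factor and the order of the factors. The face restores the order,
  and \<open>lie_rev\<close> gives one sign per factor.\<close>

lemma lie_prod_own_face_rev:
  assumes "sorted_wrt disjnt (map set Xs)" "[] \<notin> set Xs"
  shows "lie_prod Xs (\<lambda>v. f (face_act (map set Xs) (rev v))) =
    (-1) ^ (length (concat Xs) + length Xs) * lie_prod Xs f"
  using assms
proof (induction Xs arbitrary: f)
  case (Cons xs Xs)
  have disj: "set xs \<inter> \<Union> (set (map set Xs)) = {}"
    using Cons.prems by (auto simp: disjnt_def)
  let ?s = "(-1) ^ (length (concat Xs) + length Xs)"
  have "lie_prod Xs (\<lambda>v. f (face_act (map set (xs # Xs)) (rev (w @ v)))) =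
      ?s * lie_prod Xs (\<lambda>v. f (rev w @ v))" if w: "mset w = mset xs" for w
  proof -
    have sw: "set w = set xs" using w by (metis set_mset_mset)
    have "lie_prod Xs (\<lambda>v. f (face_act (map set (xs # Xs)) (rev (w @ v)))) =
      lie_prod Xs (\<lambda>v. f (rev w @ face_act (map set Xs) (rev v)))"
    proof (rule lie_prod_cong)
      fix v assume "mset v = mset (concat Xs)"
      then have "set v = set (concat Xs)" by (metis set_mset_mset)
      then have "filter (\<lambda>x. x \<in> set xs) (rev v) = []"
        using disj by (auto simp: filter_empty_conv)
      moreover have "filter (\<lambda>x. x \<in> set xs) (rev w) = rev w"
        using sw by (simp add: filter_id_conv)
      ultimately show "f (face_act (map set (xs # Xs)) (rev (w @ v))) =
          f (rev w @ face_act (map set Xs) (rev v))"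
        using disj sw by (simp add: face_act_append_disjoint Int_commute)
    qed
    also have "\<dots> = ?s * lie_prod Xs (\<lambda>v. f (rev w @ v))"
      using Cons.prems by (intro Cons.IH[of "\<lambda>v. f (rev w @ v)"]) auto
    finally show ?thesis .
  qed
  then have "lie_prod (xs # Xs) (\<lambda>v. f (face_act (map set (xs # Xs)) (rev v))) =
      lie xs (\<lambda>w. ?s * lie_prod Xs (\<lambda>v. f (rev w @ v)))"
    by (auto intro: lie_cong)
  also have "\<dots> = ?s * ((-1) ^ (length xs + 1) * lie xs (\<lambda>w. lie_prod Xs (\<lambda>v. f (w @ v))))"
    using lie_rev[of xs "\<lambda>w. lie_prod Xs (\<lambda>v. f (w @ v))"] Cons.prems by (auto simp: lie_scale)
  finally show ?case by (simp add: power_add algebra_simps)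
qed simp

text \<open>The Lie element is nonzero: the word \<open>rev xs\<close> has coefficient 1, because at
  each stage only the term with \<open>x\<close> at the end can produce it.\<close>

lemma lie_indicator:
  assumes "distinct xs"
  shows "lie xs (\<lambda>w. if w = rev xs then 1 else 0) = 1"
  using assms
proof (induction xs)
  case (Cons x xs)
  show ?case
  proof (cases xs)
    case (Cons y ys)
    have "lie xs (\<lambda>w. if x # w = rev xs @ [x] then 1 else 0 :: 'a) = lie xs (\<lambda>w. 0)"
    proof (rule lie_cong)
      fix w assume "mset w = mset xs"
      have "x # w \<noteq> rev xs @ [x]"
      proof
        assume "x # w = rev xs @ [x]"
        then have "x = hd (rev xs)" using Cons by (metis hd_append2 list.sel(1) rev_is_Nil_conv list.distinct(1))
        then have "x \<in> set xs" using Cons by (metis hd_in_set list.distinct(1) rev_is_Nil_conv set_rev)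
        then show False using Cons.prems by simp
      qed
      then show "(if x # w = rev xs @ [x] then 1 else 0) = (0 :: 'a)" by simp
    qed
    then show ?thesis using Cons.IH Cons.prems by (simp add: Cons lie_zero)
  qed simp
qed simp

lemma lie_prod_indicator:
  assumes "distinct (concat Xs)"
  shows "lie_prod Xs (\<lambda>v. if v = concat (map rev Xs) then 1 else 0) = 1"
  using assms
proof (induction Xs)
  case (Cons xs Xs)
  have "lie_prod (xs # Xs) (\<lambda>v. if v = concat (map rev (xs # Xs)) then 1 else 0) =
    lie xs (\<lambda>w. if w = rev xs then 1 else 0 :: 'a)"
    unfolding lie_prod.simps
  proof (rule lie_cong)
    fix w assume "mset w = mset xs"
    then have "length w = length (rev xs)" by (metis length_rev size_mset)
    then show "lie_prod Xs (\<lambda>v. if w @ v = concat (map rev (xs # Xs)) then 1 else 0) =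
      (if w = rev xs then 1 else 0 :: 'a)"
      using Cons by (auto simp: lie_prod_zero)
  qed
  then show ?case using Cons.prems lie_indicator[of xs] by simp
qed simp

section \<open>The spectrum of the reversed face operator\<close>

declare One_nat_def [simp del]

section \<open>The operator \<open>T\<close> and its composition with face actions\<close>

definition faces_of_type :: "nat \<Rightarrow> nat list \<Rightarrow> nat set list set" where
  "faces_of_type n \<alpha> = {G \<in> faces {1..n}. comp_type G = \<alpha>}"

text \<open>The operator \<open>T\<close>. The value 0 off words is a default that lets identities
  be stated as equations between functions.\<close>

definition step :: "nat \<Rightarrow> nat list \<Rightarrow> (nat list \<Rightarrow> 'k::field) \<Rightarrow> nat list \<Rightarrow> 'k" where
  "step n \<alpha> f C =
     (if C \<in> words {1..n} then \<Sum>G\<in>faces_of_type n \<alpha>. f (face_act G (rev C)) else 0)"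

text \<open>The transpose of the action of \<open>F\<close>, preceded by a reversal if
  \<open>e\<close> holds.\<close>

definition pull :: "nat \<Rightarrow> bool \<Rightarrow> nat set list \<Rightarrow> (nat list \<Rightarrow> 'k::field) \<Rightarrow> nat list \<Rightarrow> 'k" where
  "pull n e F f C =
     (if C \<in> words {1..n} then f (face_act F (if e then rev C else C)) else 0)"

lemma finite_faces_of_type: "finite (faces_of_type n \<alpha>)"
  by (simp add: faces_of_type_def finite_faces)

lemma lin_op_step: "lin_op (step n \<alpha>)"
  by (simp add: lin_op_def step_def fun_eq_iff sum.distrib sum_distrib_left)

lemma n_count_eq: "n_count n \<alpha> F = card {G \<in> faces_of_type n \<alpha>. F \<preceq>\<^sub>b G}"
  unfolding n_count_def faces_of_type_def set_compositions_eq_faces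
  by (rule arg_cong[where f = card]) auto

text \<open>Every face counted for \<open>F\<close> is counted for \<open>H\<close> by transitivity,
  and \<open>G\<close> is counted for \<open>H\<close> only.\<close>

lemma n_count_less:
  assumes "G \<in> faces_of_type n \<alpha>" "\<not> F \<preceq>\<^sub>b G" "H \<preceq>\<^sub>b F" "H \<preceq>\<^sub>b G"
  shows "n_count n \<alpha> F < n_count n \<alpha> H"
  unfolding n_count_eq
proof (rule psubset_card_mono)
  show "{G \<in> faces_of_type n \<alpha>. F \<preceq>\<^sub>b G} \<subset> {G \<in> faces_of_type n \<alpha>. H \<preceq>\<^sub>b G}"
    using assms refines_trans[OF assms(3)] by blast
qed (simp add: finite_faces_of_type)

text \<open>\<open>T\<close> contributes one reversal. If \<open>e\<close> holds, it meets the
  reversal already present: the two cancel after passing \<open>G\<close>, which becomes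
  \<open>rev G\<close>.\<close>

lemma step_pull:
  assumes "F \<in> faces {1..n}"
  shows "step n \<alpha> (pull n e F f) =
    (\<lambda>C. \<Sum>G\<in>faces_of_type n \<alpha>. pull n (\<not> e) (face_mult F (if e then rev G else G)) f C)"
proof
  fix C
  have "pull n e F f (face_act G (rev C)) = pull n (\<not> e) (face_mult F (if e then rev G else G)) f C"
    if "C \<in> words {1..n}" "G \<in> faces_of_type n \<alpha>" for G
  proof -
    have "face_act G (rev C) \<in> words {1..n}"
      using that by (intro face_act_in_words) (auto simp: faces_of_type_def rev_in_words)
    then show ?thesis
      using that by (simp add: pull_def rev_face_act face_act_face_act)
  qed
  then show "step n \<alpha> (pull n e F f) C =
    (\<Sum>G\<in>faces_of_type n \<alpha>. pull n (\<not> e) (face_mult F (if e then rev G else G)) f C)"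
    by (simp add: step_def pull_def[of n "\<not> e"])
qed

text \<open>The faces \<open>G\<close> with \<open>F \<preceq>\<^sub>b G\<close> satisfy
  \<open>F G = F\<close>, and also \<open>F (rev G) = F\<close>; they make up the main term. The
  factor \<open>1\<close> gives the rest the shape of \<open>lin_op_sum\<close>.\<close>

lemma step_pull_absorb:
  assumes "F \<in> faces {1..n}"
  shows "step n \<alpha> (pull n e F f) =
    (\<lambda>C. of_nat (n_count n \<alpha> F) * pull n (\<not> e) F f C +
       (\<Sum>G\<in>{G \<in> faces_of_type n \<alpha>. \<not> F \<preceq>\<^sub>b G}.
          1 * pull n (\<not> e) (face_mult F (if e then rev G else G)) f C))"
proof
  fix C
  let ?h = "\<lambda>G. pull n (\<not> e) (face_mult F (if e then rev G else G)) f C"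
  have "step n \<alpha> (pull n e F f) C =
    (\<Sum>G\<in>{G \<in> faces_of_type n \<alpha>. F \<preceq>\<^sub>b G} \<union> {G \<in> faces_of_type n \<alpha>. \<not> F \<preceq>\<^sub>b G}. ?h G)"
    unfolding step_pull[OF assms] by (rule sum.cong) auto
  also have "\<dots> = (\<Sum>G\<in>{G \<in> faces_of_type n \<alpha>. F \<preceq>\<^sub>b G}. ?h G) +
      (\<Sum>G\<in>{G \<in> faces_of_type n \<alpha>. \<not> F \<preceq>\<^sub>b G}. ?h G)"
    by (rule sum.union_disjoint) (auto simp: finite_faces_of_type)
  also have "(\<Sum>G\<in>{G \<in> faces_of_type n \<alpha>. F \<preceq>\<^sub>b G}. ?h G) =
      (\<Sum>G\<in>{G \<in> faces_of_type n \<alpha>. F \<preceq>\<^sub>b G}. pull n (\<not> e) F f C)"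
    using face_mult_absorb[OF assms]
    by (intro sum.cong) (auto simp: faces_of_type_def rev_in_faces refines_rev)
  finally show "step n \<alpha> (pull n e F f) C = of_nat (n_count n \<alpha> F) * pull n (\<not> e) F f C +
       (\<Sum>G\<in>{G \<in> faces_of_type n \<alpha>. \<not> F \<preceq>\<^sub>b G}. 1 * ?h G)"
    by (simp add: n_count_eq)
qed

section \<open>An annihilating product of distinct factors, signs undetermined\<close>

definition root_prod :: "int set \<Rightarrow> 'k::field poly" where
  "root_prod S = (\<Prod>k\<in>S. [:- of_int k, 1:])"

lemma root_prod_dvd: "finite S \<Longrightarrow> R \<subseteq> S \<Longrightarrow> root_prod R dvd root_prod S"
  unfolding root_prod_def by (rule prod_dvd_prod_subset)

lemma root_prod_Un: "finite R \<Longrightarrow> finite S \<Longrightarrow> R \<inter> S = {} \<Longrightarrow> root_prod (R \<union> S) = root_prod R * root_prod S"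
  unfolding root_prod_def by (rule prod.union_disjoint)

text \<open>The candidate eigenvalues for the layers with \<open>n_count\<close> at least
  \<open>m\<close>, before the signs are known.\<close>

definition signed_counts :: "nat \<Rightarrow> nat list \<Rightarrow> nat \<Rightarrow> int set" where
  "signed_counts n \<alpha> m = {k. nat \<bar>k\<bar> \<in> n_count n \<alpha> ` faces {1..n} \<and> m \<le> nat \<bar>k\<bar>}"

lemma finite_signed_counts: "finite (signed_counts n \<alpha> m)"
proof (rule finite_subset)
  let ?N = "n_count n \<alpha> ` faces {1..n}"
  show "signed_counts n \<alpha> m \<subseteq> int ` ?N \<union> (\<lambda>k. - int k) ` ?N"
  proof
    fix k assume "k \<in> signed_counts n \<alpha> m"
    then have "nat \<bar>k\<bar> \<in> ?N" by (simp add: signed_counts_def)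
    moreover have "k = int (nat \<bar>k\<bar>) \<or> k = - int (nat \<bar>k\<bar>)" by auto
    ultimately show "k \<in> int ` ?N \<union> (\<lambda>k. - int k) ` ?N" by blast
  qed
qed (simp add: finite_faces)

text \<open>Reversal may change sign on each layer of constant \<open>n_count\<close>, so the roots here come in
  pairs \<open>\<plusminus>m\<close>; the point is that they are simple, \<open>0\<close> included.\<close>

lemma papp_signed_counts_zero:
  assumes "F \<in> faces {1..n}"
  shows "papp (step n \<alpha>) (root_prod (signed_counts n \<alpha> (n_count n \<alpha> F))) (pull n e F f) = (\<lambda>_. 0)"
  using assms
proof (induction "card (faces_of_type n \<alpha>) - n_count n \<alpha> F" arbitrary: F e f rule: less_induct)
  case less
  let ?T = "step n \<alpha> :: (nat list \<Rightarrow> 'a) \<Rightarrow> _"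
  let ?m = "n_count n \<alpha> F"
  \<comment> \<open>By induction \<open>P\<close> kills every face with a larger count, so that only
    the main term of \<open>step_pull_absorb\<close> survives.\<close>
  define P where "P = (root_prod (signed_counts n \<alpha> (Suc ?m)) :: 'a poly)"
  define g where "g e = papp ?T P (pull n e F f)" for e
  have le: "n_count n \<alpha> H \<le> card (faces_of_type n \<alpha>)" for H
    unfolding n_count_eq by (rule card_mono) (auto simp: finite_faces_of_type)
  have higher: "papp ?T P (pull n e H f) = (\<lambda>_. 0)"
    if "H \<in> faces {1..n}" "?m < n_count n \<alpha> H" for e H
  proof (rule papp_dvd_zero[OF lin_op_step])
    show "papp ?T (root_prod (signed_counts n \<alpha> (n_count n \<alpha> H))) (pull n e H f) = (\<lambda>_. 0)"
      using that le[of H] by (intro less.hyps) auto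
    show "root_prod (signed_counts n \<alpha> (n_count n \<alpha> H)) dvd P"
      unfolding P_def using that
      by (intro root_prod_dvd finite_signed_counts) (auto simp: signed_counts_def)
  qed
  \<comment> \<open>Up to the factor \<open>?m\<close>, the operator interchanges the versions with
    and without reversal.\<close>
  have step_g: "?T (g e) = (\<lambda>C. of_nat ?m * g (\<not> e) C)" for e
  proof -
    let ?H = "\<lambda>G. face_mult F (if e then rev G else G)"
    have "papp ?T P (pull n (\<not> e) (?H G) f) = (\<lambda>_. 0)"
      if "G \<in> {G \<in> faces_of_type n \<alpha>. \<not> F \<preceq>\<^sub>b G}" for G
    proof (rule higher)
      show "?H G \<in> faces {1..n}"
        using that less.prems by (auto intro!: face_mult_in_faces simp: faces_of_type_def rev_in_faces)
      show "?m < n_count n \<alpha> (?H G)"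
        using that face_mult_refines(1)[of F] face_mult_refines(2)[of F G]
          face_mult_refines(2)[of F "rev G"]
        by (intro n_count_less[of G]) (auto simp: refines_rev)
    qed
    then have "(\<Sum>G\<in>{G \<in> faces_of_type n \<alpha>. \<not> F \<preceq>\<^sub>b G}. 1 * papp ?T P (pull n (\<not> e) (?H G) f) C) = 0" for C
      by (intro sum.neutral) simp
    then show ?thesis
      unfolding g_def papp_commute[OF lin_op_step, symmetric] step_pull_absorb[OF less.prems]
      by (simp only: lin_op_add[OF lin_op_papp[OF lin_op_step]]
          lin_op_scale[OF lin_op_papp[OF lin_op_step]] lin_op_sum[OF lin_op_papp[OF lin_op_step]] add_0_right)
  qed
  have m: "?m \<in> n_count n \<alpha> ` faces {1..n}" using less.prems by simp
  have "signed_counts n \<alpha> ?m = {int ?m, - int ?m} \<union> signed_counts n \<alpha> (Suc ?m)"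
  proof (intro Set.set_eqI iffI)
    fix k assume k: "k \<in> signed_counts n \<alpha> ?m"
    show "k \<in> {int ?m, - int ?m} \<union> signed_counts n \<alpha> (Suc ?m)"
    proof (cases "nat \<bar>k\<bar> = ?m")
      case True
      then show ?thesis by auto
    next
      case False
      then show ?thesis using k by (auto simp: signed_counts_def)
    qed
  next
    fix k assume "k \<in> {int ?m, - int ?m} \<union> signed_counts n \<alpha> (Suc ?m)"
    then show "k \<in> signed_counts n \<alpha> ?m" using m by (auto simp: signed_counts_def)
  qed
  moreover have "{int ?m, - int ?m} \<inter> signed_counts n \<alpha> (Suc ?m) = {}"
    by (auto simp: signed_counts_def)
  ultimately have "root_prod (signed_counts n \<alpha> ?m) = root_prod {int ?m, - int ?m} * P"
    unfolding P_def by (simp only: root_prod_Un finite_signed_counts finite.intros)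
  then have "papp ?T (root_prod (signed_counts n \<alpha> ?m)) (pull n e F f) =
      papp ?T (root_prod {int ?m, - int ?m}) (g e)"
    by (simp add: papp_mult[OF lin_op_step] g_def)
  also have "\<dots> = (\<lambda>_. 0)"
  \<comment> \<open>For \<open>?m = 0\<close> the two roots coincide and \<open>T (g e) = 0\<close>
    at once. Otherwise two uses of \<open>step_g\<close> give
    \<open>T (T (g e)) = ?m^2 (g e)\<close>, which the factors for \<open>?m\<close> and
    \<open>- ?m\<close> annihilate.\<close>
  proof (cases "?m = 0")
    case True
    then show ?thesis using step_g[of e] by (simp add: root_prod_def papp_linear)
  next
    case False
    then have "int ?m \<noteq> - int ?m" by auto
    then have "root_prod {int ?m, - int ?m} = [:- of_nat ?m, 1:] * [:of_nat ?m, 1 :: 'a:]"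
      by (simp only: root_prod_def prod.insert finite.intros prod.empty insert_iff empty_iff mult_1_right) simp
    then show ?thesis
      by (simp only: papp_mult[OF lin_op_step] papp_linear step_g
          lin_op_add[OF lin_op_step] lin_op_scale[OF lin_op_step]) (simp add: algebra_simps)
  qed
  finally show ?case .
qed

section \<open>Evaluation on Lie elements and triangularity under refinement\<close>

lemma pull_True_expand:
  assumes "F \<in> faces {1..n}"
  shows "pull n True F f =
    (\<lambda>C. \<Sum>G\<in>faces {1..n}. (-1) ^ (n + length G) * pull n False (face_mult F G) f C)"
proof
  fix C
  show "pull n True F f C =
    (\<Sum>G\<in>faces {1..n}. (-1) ^ (n + length G) * pull n False (face_mult F G) f C)"
    using reverse_as_sum_of_faces[of "{1..n}" C "\<lambda>D. f (face_act F D)"]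
    by (simp add: pull_def face_act_face_act)
qed

text \<open>Sorting merely fixes some order of the letters within each block.\<close>

definition lie_face :: "nat set list \<Rightarrow> (nat list \<Rightarrow> 'k::field) \<Rightarrow> 'k" where
  "lie_face F f = lie_prod (map sorted_list_of_set F) f"

lemma lin_op_lie_face: "lin_op (\<lambda>f (_ :: unit). lie_face F f)"
  unfolding lie_face_def by (rule lin_op_lie_prod)

lemma lie_face_sum: "lie_face F (\<lambda>x. \<Sum>i\<in>I. c i * f i x) = (\<Sum>i\<in>I. c i * lie_face F (f i))"
  using lin_op_sum[OF lin_op_lie_face, of F c f I] by (simp add: fun_eq_iff)

lemma lie_face_add: "lie_face F (\<lambda>x. f x + g x) = lie_face F f + lie_face F g"
  using lin_op_add[OF lin_op_lie_face, of F f g] by (simp add: fun_eq_iff)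

lemma lie_face_scale: "lie_face F (\<lambda>x. c * f x) = c * lie_face F f"
  using lin_op_scale[OF lin_op_lie_face, of F c f] by (simp add: fun_eq_iff)

context
  fixes n :: nat and F :: "nat set list"
  assumes F: "F \<in> faces {1..n}"
begin

lemma finite_blocks: "S \<in> set F \<Longrightarrow> finite S"
  using F by (auto simp: faces_def intro: finite_subset)

lemma map_set_sorted_blocks: "map set (map sorted_list_of_set F) = F"
  using finite_blocks by (auto intro!: map_idI)

lemma sorted_blocks_nonempty: "[] \<notin> set (map sorted_list_of_set F)"
proof
  assume "[] \<in> set (map sorted_list_of_set F)"
  then obtain S where "S \<in> set F" "sorted_list_of_set S = []" by auto
  then show False using F finite_blocks[of S] by (simp add: faces_def)
qed

lemma length_concat_sorted_blocks: "length (concat (map sorted_list_of_set F)) = n"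
proof -
  have "length (concat (map sorted_list_of_set F)) = sum_list (map card F)"
    using finite_blocks by (simp add: length_concat comp_def)
  then show ?thesis using sum_card_faces[OF _ F] by simp
qed

lemma concat_sorted_blocks: "concat (map sorted_list_of_set F) \<in> words {1..n}"
proof -
  have "set (concat (map sorted_list_of_set F)) = {1..n}"
    using F finite_blocks by (auto simp: faces_def)
  moreover have "distinct (concat (map sorted_list_of_set F))"
    using calculation length_concat_sorted_blocks by (simp add: card_distinct)
  ultimately show ?thesis by (simp add: words_def)
qed

text \<open>The default value in \<open>pull\<close> is never met: only words on
  \<open>{1..n}\<close> occur in the Lie product.\<close>

lemma lie_face_pull:
  "lie_face F (pull n e G f) =
    lie_prod (map sorted_list_of_set F) (\<lambda>v. f (face_act G (if e then rev v else v)))"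
  unfolding lie_face_def
proof (rule lie_prod_cong)
  fix w assume w: "mset w = mset (concat (map sorted_list_of_set F))"
  then have "distinct w \<and> set w = {1..n}"
    using concat_sorted_blocks mset_eq_imp_distinct_iff[OF w] mset_eq_setD[OF w]
    by (simp add: words_def)
  then show "pull n e G f w = f (face_act G (if e then rev w else w))"
    by (simp add: pull_def words_def)
qed

lemma lie_face_zero_unless_refines:
  assumes "G \<in> faces {1..n}" "\<not> F \<preceq>\<^sub>b G"
  shows "lie_face F (pull n False G f) = 0"
proof -
  have U: "\<Union> (set F) = {1..n}" using F by (simp add: faces_def)
  show ?thesis
    using lie_prod_face_zero[OF assms(1), of "map sorted_list_of_set F" f "[]"]
    unfolding lie_face_pull map_set_sorted_blocks U using sorted_blocks_nonempty assms(2) by simp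
qed

lemma lie_face_pull_self: "lie_face F (pull n False F f) = lie_face F f"
  using lie_prod_own_face[of "map sorted_list_of_set F" f] F
  unfolding lie_face_pull map_set_sorted_blocks by (simp add: lie_face_def faces_def)

lemma lie_face_pull_self_rev: "lie_face F (pull n True F f) = (-1) ^ (n + length F) * lie_face F f"
  using lie_prod_own_face_rev[of "map sorted_list_of_set F" f] F sorted_blocks_nonempty
  unfolding lie_face_pull map_set_sorted_blocks length_concat_sorted_blocks
  by (simp add: lie_face_def faces_def)

lemma lie_face_nonzero: obtains f :: "nat list \<Rightarrow> 'k::field" where "lie_face F f = 1"
  using lie_prod_indicator[of "map sorted_list_of_set F"] concat_sorted_blocks that
  unfolding lie_face_def words_def by blast

text \<open>The coefficient of \<open>F\<close> in the expansion of reversal, read off on a Lie element.\<close>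

lemma sum_sign_coarsenings:
  "(\<Sum>G | G \<in> faces {1..n} \<and> F \<preceq>\<^sub>b G. (-1) ^ (n + length G)) = ((-1) ^ (n + length F) :: 'k::field)"
proof -
  obtain f :: "nat list \<Rightarrow> 'k" where f: "lie_face F f = 1" by (rule lie_face_nonzero)
  have "(-1) ^ (n + length F) = lie_face F (pull n True F f)"
    by (simp add: lie_face_pull_self_rev f)
  also have "\<dots> = (\<Sum>G\<in>faces {1..n}. (-1) ^ (n + length G) * lie_face F (pull n False (face_mult F G) f))"
    by (simp add: pull_True_expand[OF F] lie_face_sum)
  \<comment> \<open>If \<open>F\<close> does not refine \<open>G\<close>, it does not refine the
    finer face \<open>F G\<close> either, so the Lie product is killed.\<close>
  also have "\<dots> = (\<Sum>G\<in>faces {1..n}. if F \<preceq>\<^sub>b G then (-1) ^ (n + length G) else 0)"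
  proof (rule sum.cong)
    fix G assume G: "G \<in> faces {1..n}"
    show "(-1) ^ (n + length G) * lie_face F (pull n False (face_mult F G) f) =
      (if F \<preceq>\<^sub>b G then (-1) ^ (n + length G) else 0)"
    proof (cases "F \<preceq>\<^sub>b G")
      case True
      then show ?thesis by (simp add: face_mult_absorb[OF F G] lie_face_pull_self f)
    next
      case False
      then have "\<not> F \<preceq>\<^sub>b face_mult F G"
        using face_mult_refines(2) refines_trans by blast
      then show ?thesis
        using False lie_face_zero_unless_refines[OF face_mult_in_faces[OF F G]] by simp
    qed
  qed simp
  also have "\<dots> = (\<Sum>G | G \<in> faces {1..n} \<and> F \<preceq>\<^sub>b G. (-1) ^ (n + length G))"
    by (subst sum.inter_filter[symmetric]) (simp_all add: finite_faces)
  finally show ?thesis by simp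
qed

text \<open>A face has at most \<open>n\<close> blocks, so the natural-number subtraction in
  \<open>n_tilde\<close> is a true one, and difference and sum have equal parity.\<close>

lemma n_tilde_eq: "n_tilde n \<alpha> F = (-1) ^ (n + length F) * int (n_count n \<alpha> F)"
proof -
  have "length F \<le> n" using length_faces_le[OF _ F] by simp
  then have "(-1) ^ (n + length F) = ((-1) ^ (n - length F) :: int)"
    by (auto simp: minus_one_power_iff)
  then show ?thesis by (simp add: n_tilde_def)
qed

text \<open>Applying \<open>T\<close> and expanding the reversal by Takeuchi's formula gives a
  signed sum over the faces \<open>F G G'\<close>. This is \<open>F\<close> if both \<open>G\<close>
  and \<open>G'\<close> coarsen \<open>F\<close>, and strictly finer otherwise.\<close>

lemma step_pull_triangular:
  obtains I :: "(nat set list \<times> nat set list) set" and h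
    and c :: "nat set list \<times> nat set list \<Rightarrow> 'k::field"
  where "\<And>i. i \<in> I \<Longrightarrow> h i \<in> faces {1..n} \<and> h i \<preceq>\<^sub>b F \<and> \<not> F \<preceq>\<^sub>b h i"
    and "\<And>f. step n \<alpha> (pull n False F f) =
      (\<lambda>C. of_int (n_tilde n \<alpha> F) * pull n False F f C + (\<Sum>i\<in>I. c i * pull n False (h i) f C))"
proof -
  define X where "X = faces_of_type n \<alpha> \<times> faces {1..n}"
  define J where "J = {G \<in> faces_of_type n \<alpha>. F \<preceq>\<^sub>b G} \<times> {G. G \<in> faces {1..n} \<and> F \<preceq>\<^sub>b G}"
  define c :: "nat set list \<times> nat set list \<Rightarrow> 'k" where "c = (\<lambda>(G, G'). (-1) ^ (n + length G'))"
  define h where "h = (\<lambda>(G, G'). face_mult (face_mult F G) G')"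
  have fin: "finite X" and JX: "J \<subseteq> X"
    by (auto simp: X_def J_def finite_faces finite_faces_of_type)
  have type_faces: "faces_of_type n \<alpha> \<subseteq> faces {1..n}" by (auto simp: faces_of_type_def)
  show thesis
  proof (rule that[of "X - J" h c])
    fix i assume i: "i \<in> X - J"
    obtain G G' where GG: "i = (G, G')" by (cases i)
    have "face_mult F G \<in> faces {1..n}"
      using i type_faces by (auto simp: X_def GG intro: face_mult_in_faces[OF F])
    then have "h i \<in> faces {1..n}"
      using i by (auto simp: X_def h_def GG intro: face_mult_in_faces)
    moreover have hG: "h i \<preceq>\<^sub>b face_mult F G" "h i \<preceq>\<^sub>b G'"
      by (simp_all add: h_def GG face_mult_refines)
    moreover have "h i \<preceq>\<^sub>b F" "h i \<preceq>\<^sub>b G"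
      using hG(1) face_mult_refines refines_trans by blast+
    \<comment> \<open>If \<open>F\<close> refined \<open>h i\<close>, it would refine both
      \<open>G\<close> and \<open>G'\<close>, and the pair would lie in \<open>J\<close>.\<close>
    ultimately show "h i \<in> faces {1..n} \<and> h i \<preceq>\<^sub>b F \<and> \<not> F \<preceq>\<^sub>b h i"
      using i refines_trans by (auto simp: X_def J_def GG)
  next
    fix f
    show "step n \<alpha> (pull n False F f) =
      (\<lambda>C. of_int (n_tilde n \<alpha> F) * pull n False F f C + (\<Sum>i\<in>X - J. c i * pull n False (h i) f C))"
    proof
      fix C
      have "step n \<alpha> (pull n False F f) C =
        (\<Sum>G\<in>faces_of_type n \<alpha>. \<Sum>G'\<in>faces {1..n}. c (G, G') * pull n False (h (G, G')) f C)"
        unfolding step_pull[OF F]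
      proof (rule sum.cong)
        fix G assume "G \<in> faces_of_type n \<alpha>"
        then have "face_mult F G \<in> faces {1..n}"
          using type_faces by (auto intro: face_mult_in_faces[OF F])
        from pull_True_expand[OF this, of f]
        show "pull n (\<not> False) (face_mult F (if False then rev G else G)) f C =
          (\<Sum>G'\<in>faces {1..n}. c (G, G') * pull n False (h (G, G')) f C)"
          by (simp add: c_def h_def)
      qed simp
      also have "\<dots> = (\<Sum>i\<in>X. c i * pull n False (h i) f C)"
        unfolding X_def sum.cartesian_product by (rule sum.cong) auto
      also have "\<dots> = (\<Sum>i\<in>X - J. c i * pull n False (h i) f C) + (\<Sum>i\<in>J. c i * pull n False (h i) f C)"
        by (rule sum.subset_diff[OF JX fin])
      also have "(\<Sum>i\<in>J. c i * pull n False (h i) f C) = (\<Sum>i\<in>J. c i) * pull n False F f C"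
        unfolding sum_distrib_right
      proof (rule sum.cong)
        fix i assume i: "i \<in> J"
        obtain G G' where GG: "i = (G, G')" by (cases i)
        have "face_mult F G = F" "face_mult F G' = F"
          using i type_faces by (auto simp: J_def GG intro!: face_mult_absorb[OF F])
        then show "c i * pull n False (h i) f C = c i * pull n False F f C"
          by (simp add: h_def GG)
      qed simp
      \<comment> \<open>The sum factors: the choices of \<open>G\<close> number
        \<open>n_count\<close>, and the signs of \<open>G'\<close> add up by
        \<open>sum_sign_coarsenings\<close>.\<close>
      also have "(\<Sum>i\<in>J. c i) = of_int (n_tilde n \<alpha> F)"
        unfolding J_def c_def
        by (simp add: sum.cartesian_product[symmetric] sum_sign_coarsenings n_tilde_eq n_count_eq mult.commute)
      finally show "step n \<alpha> (pull n False F f) C =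
        of_int (n_tilde n \<alpha> F) * pull n False F f C + (\<Sum>i\<in>X - J. c i * pull n False (h i) f C)"
        by simp
    qed
  qed
qed

end

text \<open>Passing to a strictly finer face increases the number of coarsenings, so the induction
  runs from fine to coarse and spends one factor \<open>?Q\<close> per step. The \<open>Suc\<close>
  keeps the exponent positive.\<close>

lemma papp_n_tilde_power_zero:
  fixes f :: "nat list \<Rightarrow> 'k::field"
  assumes "F \<in> faces {1..n}"
  shows "papp (step n \<alpha>) (root_prod (n_tilde n \<alpha> ` faces {1..n}) ^
    (Suc (card (faces {1..n})) - card {G \<in> faces {1..n}. F \<preceq>\<^sub>b G})) (pull n False F f) = (\<lambda>_. 0)"
    (is "papp _ (?Q ^ (?N - ?d F)) _ = _")
  using assms
proof (induction "?N - ?d F" arbitrary: F rule: less_induct)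
  case less
  let ?T = "step n \<alpha> :: (nat list \<Rightarrow> 'k) \<Rightarrow> _"
  have le: "?d H \<le> card (faces {1..n})" for H
    by (rule card_mono) (auto simp: finite_faces)
  define m where "m = ?N - ?d F - 1"
  have m: "?N - ?d F = Suc m" using le[of F] by (simp add: m_def)
  obtain I h and c :: "nat set list \<times> nat set list \<Rightarrow> 'k" where
    h: "\<And>i. i \<in> I \<Longrightarrow> h i \<in> faces {1..n} \<and> h i \<preceq>\<^sub>b F \<and> \<not> F \<preceq>\<^sub>b h i" and
    T: "\<And>f. ?T (pull n False F f) =
      (\<lambda>C. of_int (n_tilde n \<alpha> F) * pull n False F f C + (\<Sum>i\<in>I. c i * pull n False (h i) f C))"
    by (rule step_pull_triangular[OF less.prems, where \<alpha> = \<alpha> and ?'k = 'k]) (rule that)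
  have finer: "papp ?T (?Q ^ m) (pull n False (h i) f) = (\<lambda>_. 0)" if i: "i \<in> I" for i
  proof (rule papp_dvd_zero[OF lin_op_step])
    have "?d F < ?d (h i)"
    proof (rule psubset_card_mono)
      show "{G \<in> faces {1..n}. F \<preceq>\<^sub>b G} \<subset> {G \<in> faces {1..n}. h i \<preceq>\<^sub>b G}"
        using h[OF i] refines_trans[of "h i" F] refines_refl[of "h i"] by blast
    qed (simp add: finite_faces)
    then have lt: "?N - ?d (h i) < ?N - ?d F" using le[of "h i"] by linarith
    then show "papp ?T (?Q ^ (?N - ?d (h i))) (pull n False (h i) f) = (\<lambda>_. 0)"
      using h[OF i] by (intro less.hyps) auto
    show "?Q ^ (?N - ?d (h i)) dvd ?Q ^ m"
      using lt m by (intro le_imp_power_dvd) linarith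
  qed
  define g where "g = papp ?T (?Q ^ m) (pull n False F f)"
  have "(\<Sum>i\<in>I. c i * papp ?T (?Q ^ m) (pull n False (h i) f) C) = 0" for C
    using finer by (intro sum.neutral) simp
  \<comment> \<open>\<open>?Q ^ m\<close> kills the strictly finer faces, which leaves an
    eigenvector whose eigenvalue is a root of \<open>?Q\<close>.\<close>
  then have "?T g = (\<lambda>C. of_int (n_tilde n \<alpha> F) * g C)"
    unfolding g_def papp_commute[OF lin_op_step, symmetric] T
    by (simp only: lin_op_add[OF lin_op_papp[OF lin_op_step]]
        lin_op_scale[OF lin_op_papp[OF lin_op_step]] lin_op_sum[OF lin_op_papp[OF lin_op_step]] add_0_right)
  then have "papp ?T ?Q g = (\<lambda>C. poly ?Q (of_int (n_tilde n \<alpha> F)) * g C)"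
    by (rule papp_eigen[OF lin_op_step])
  moreover have "poly ?Q (of_int (n_tilde n \<alpha> F)) = (0 :: 'k)"
    using less.prems by (auto simp: root_prod_def poly_prod finite_faces)
  ultimately show ?case
    by (simp add: m papp_mult[OF lin_op_step] g_def)
qed

section \<open>The asserted polynomial annihilates \<open>T\<close>, and its roots are
  forced\<close>

definition top_face :: "nat \<Rightarrow> nat set list" where
  "top_face n = (if n = 0 then [] else [{1..n}])"

lemma top_face_in_faces: "top_face n \<in> faces {1..n}"
  by (simp add: top_face_def faces_def)

text \<open>The face with a single block is the identity of the face monoid; for
  \<open>n = 0\<close> it is the empty list, since blocks are nonempty.\<close>

lemma pull_top_face: "C \<in> words {1..n} \<Longrightarrow> pull n False (top_face n) f C = f C"
  using face_act_single[of C "{1..n}"] by (auto simp: top_face_def pull_def words_def)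

lemma papp_step_root_prod_zero:
  fixes f :: "nat list \<Rightarrow> 'k::field_char_0"
  shows "papp (step n \<alpha>) (root_prod (n_tilde n \<alpha> ` faces {1..n})) (pull n False (top_face n) f) = (\<lambda>_. 0)"
proof -
  let ?K = "n_tilde n \<alpha> ` faces {1..n}" and ?S = "signed_counts n \<alpha> 0"
  let ?Q = "root_prod ?K :: 'k poly"
  have K: "finite ?K" by (simp add: finite_faces)
  have "?K \<subseteq> ?S"
    by (auto simp: signed_counts_def n_tilde_def abs_mult power_abs)
  then have S: "?S = (?S - ?K) \<union> ?K" by blast
  \<comment> \<open>Characteristic 0 keeps distinct integers distinct in the field.\<close>
  have inj: "inj_on (of_int :: int \<Rightarrow> 'k) (?S - ?K)" by (simp add: inj_on_def)
  have "root_prod ?S = root_prod (?S - ?K) * ?Q"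
    by (subst S, subst root_prod_Un) (auto simp: finite_signed_counts K)
  also have "root_prod (?S - ?K) = (\<Prod>k\<in>of_int ` (?S - ?K). [:- k, 1 :: 'k:])"
    by (simp add: root_prod_def prod.reindex[OF inj])
  finally have split: "root_prod ?S = (\<Prod>k\<in>of_int ` (?S - ?K). [:- k, 1:]) * ?Q" .
  show ?thesis
  proof (rule papp_drop_factors[OF lin_op_step papp_n_tilde_power_zero[OF top_face_in_faces]])
    show "papp (step n \<alpha>) ((\<Prod>k\<in>of_int ` (?S - ?K). [:- k, 1:]) * ?Q)
        (pull n False (top_face n) f) = (\<lambda>_. 0)"
      unfolding split[symmetric]
    proof (rule papp_dvd_zero[OF lin_op_step _ papp_signed_counts_zero[OF top_face_in_faces]])
      show "root_prod (signed_counts n \<alpha> (n_count n \<alpha> (top_face n))) dvd root_prod ?S"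
        by (intro root_prod_dvd finite_signed_counts) (auto simp: signed_counts_def)
    qed
    show "finite (of_int ` (?S - ?K) :: 'k set)" by (simp add: finite_signed_counts)
    fix k :: 'k assume "k \<in> of_int ` (?S - ?K)"
    then have "poly ?Q k \<noteq> 0"
      using K by (auto simp: root_prod_def poly_prod)
    then show "poly (?Q ^ (Suc (card (faces {1..n})) - card {G \<in> faces {1..n}. top_face n \<preceq>\<^sub>b G})) k \<noteq> 0"
      by simp
  qed
qed

text \<open>\<open>lie_face F\<close> vanishes on the span of the faces that \<open>F\<close> does
  not refine. That span is stable under \<open>T\<close>, and modulo it \<open>T\<close> multiplies
  the term of \<open>F\<close> by \<open>n_tilde n \<alpha> F\<close>. Evaluating
  \<open>q(T)\<close> there gives the value of \<open>q\<close>.\<close>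

lemma poly_n_tilde_zero:
  fixes q :: "'k::field poly"
  assumes F: "F \<in> faces {1..n}" and zero: "\<And>f C. C \<in> words {1..n} \<Longrightarrow> papp (step n \<alpha>) q f C = 0"
  shows "poly q (of_int (n_tilde n \<alpha> F)) = 0"
proof -
  let ?T = "step n \<alpha> :: (nat list \<Rightarrow> 'k) \<Rightarrow> _"
  let ?k = "of_int (n_tilde n \<alpha> F) :: 'k"
  note lin = lin_op_add[OF lin_op_funpow[OF lin_op_step]] lin_op_scale[OF lin_op_funpow[OF lin_op_step]]
    lin_op_sum[OF lin_op_funpow[OF lin_op_step]] lie_face_add lie_face_scale lie_face_sum
  have vanish: "lie_face F ((?T ^^ i) (pull n False H f)) = 0"
    if "H \<in> faces {1..n}" "\<not> F \<preceq>\<^sub>b H" for i H f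
    using that
  proof (induction i arbitrary: H)
    case 0
    then show ?case by (simp add: lie_face_zero_unless_refines[OF F])
  next
    case (Suc i)
    obtain I h and c :: "nat set list \<times> nat set list \<Rightarrow> 'k" where
      h: "\<And>i. i \<in> I \<Longrightarrow> h i \<in> faces {1..n} \<and> h i \<preceq>\<^sub>b H \<and> \<not> H \<preceq>\<^sub>b h i" and
      T: "\<And>f. ?T (pull n False H f) =
        (\<lambda>C. of_int (n_tilde n \<alpha> H) * pull n False H f C + (\<Sum>i\<in>I. c i * pull n False (h i) f C))"
      by (rule step_pull_triangular[OF Suc.prems(1), where \<alpha> = \<alpha> and ?'k = 'k]) (rule that)
    have "lie_face F ((?T ^^ i) (pull n False (h j) f)) = 0" if "j \<in> I" for j
      using h[OF that] Suc.prems refines_trans by (intro Suc.IH) blast+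
    moreover have "lie_face F ((?T ^^ i) (pull n False H f)) = 0"
      using Suc.prems by (rule Suc.IH)
    ultimately show ?case
      by (simp add: funpow_swap1 T lin)
  qed
  obtain I h and c :: "nat set list \<times> nat set list \<Rightarrow> 'k" where
    h: "\<And>i. i \<in> I \<Longrightarrow> h i \<in> faces {1..n} \<and> h i \<preceq>\<^sub>b F \<and> \<not> F \<preceq>\<^sub>b h i" and
    T: "\<And>f. ?T (pull n False F f) =
      (\<lambda>C. of_int (n_tilde n \<alpha> F) * pull n False F f C + (\<Sum>i\<in>I. c i * pull n False (h i) f C))"
    by (rule step_pull_triangular[OF F, where \<alpha> = \<alpha> and ?'k = 'k]) (rule that)
  have eigen: "lie_face F ((?T ^^ i) (pull n False F f)) = ?k ^ i * lie_face F f" for i f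
  proof (induction i)
    case 0
    then show ?case by (simp add: lie_face_pull_self[OF F])
  next
    case (Suc i)
    have "lie_face F ((?T ^^ i) (pull n False (h j) f)) = 0" if "j \<in> I" for j
      using h[OF that] by (intro vanish) auto
    then show ?case using Suc by (simp add: funpow_swap1 T lin)
  qed
  obtain f :: "nat list \<Rightarrow> 'k" where f: "lie_face F f = 1" by (rule lie_face_nonzero[OF F])
  define g where "g = papp ?T q (pull n False F f)"
  have "lie_face F g = (\<Sum>i\<le>degree q. coeff q i * ?k ^ i)"
    unfolding g_def papp_def by (simp add: lie_face_sum eigen f)
  \<comment> \<open>\<open>zero\<close> speaks of words only, but those are all that the Lie product
    contains.\<close>
  moreover have "lie_face F g = lie_face F (\<lambda>C. 0 * g C)"
    unfolding lie_face_def
  proof (rule lie_prod_cong)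
    fix w assume w: "mset w = mset (concat (map sorted_list_of_set F))"
    then have "w \<in> words {1..n}"
      using concat_sorted_blocks[OF F] mset_eq_imp_distinct_iff[OF w] mset_eq_setD[OF w]
      by (simp add: words_def)
    then show "g w = 0 * g w"
      by (simp add: g_def zero)
  qed
  moreover have "lie_face F (\<lambda>C. 0 * g C) = 0"
    unfolding lie_face_scale by simp
  ultimately show ?thesis
    by (simp add: poly_altdef)
qed

declare One_nat_def [simp]

section \<open>Descent classes and faces\<close>

fun segments :: "nat list \<Rightarrow> 'a list \<Rightarrow> 'a list list" where
  "segments [] w = []"
| "segments (a # \<alpha>) w = take a w # segments \<alpha> (drop a w)"

lemma concat_segments: "length w = sum_list \<alpha> \<Longrightarrow> concat (segments \<alpha> w) = w"
  by (induction \<alpha> w rule: segments.induct) auto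

lemma map_length_segments: "length w = sum_list \<alpha> \<Longrightarrow> map length (segments \<alpha> w) = \<alpha>"
  by (induction \<alpha> w rule: segments.induct) auto

lemma segments_concat: "segments (map length Xs) (concat Xs) = Xs"
  by (induction Xs) auto

lemma segments_map: "segments \<alpha> (map f w) = map (map f) (segments \<alpha> w)"
  by (induction \<alpha> w rule: segments.induct) (auto simp: take_map drop_map)

lemma partial_sums_Cons:
  "partial_sums (a # \<alpha>) = (if \<alpha> = [] then {} else insert a ((+) a ` partial_sums \<alpha>))"
proof (cases \<alpha>)
  case (Cons b \<beta>)
  have "{1..<length (a # \<alpha>)} = insert 1 (Suc ` {1..<length \<alpha>})"
    by (auto simp: Cons image_Suc_atLeastLessThan)
  then have "partial_sums (a # \<alpha>) =
      insert a ((\<lambda>i. sum_list (take i (a # \<alpha>))) ` Suc ` {1..<length \<alpha>})"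
    unfolding partial_sums_def by (simp only: image_insert) simp
  then show ?thesis
    unfolding partial_sums_def image_image by (simp add: Cons)
qed (simp add: partial_sums_def)

text \<open>A descent inside a piece is exactly what sortedness forbids. Lists are indexed from 0
  and descents from 1, whence \<open>Suc i\<close>.\<close>

lemma sorted_segments_iff:
  fixes w :: "nat list"
  assumes "length w = sum_list \<alpha>" "\<forall>a\<in>set \<alpha>. 0 < a"
  shows "(\<forall>s\<in>set (segments \<alpha> w). sorted s) \<longleftrightarrow>
    (\<forall>i. Suc i < length w \<longrightarrow> w ! Suc i < w ! i \<longrightarrow> Suc i \<in> partial_sums \<alpha>)"
  using assms
proof (induction \<alpha> w rule: segments.induct)
  case (1 w)
  then show ?case by simp
next
  case (2 a \<alpha> w)
  have a: "0 < a" "a \<le> length w" using "2.prems" by auto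
  have IH: "(\<forall>s\<in>set (segments \<alpha> (drop a w)). sorted s) \<longleftrightarrow>
    (\<forall>i. a + Suc i < length w \<longrightarrow> w ! (a + Suc i) < w ! (a + i) \<longrightarrow> Suc i \<in> partial_sums \<alpha>)"
    using "2.prems" a by (subst "2.IH") (auto simp: less_diff_conv add.commute)
  have first: "sorted (take a w) \<longleftrightarrow> (\<forall>i. Suc i < a \<longrightarrow> \<not> w ! Suc i < w ! i)"
    using a by (auto simp: sorted_iff_nth_Suc not_less)
  \<comment> \<open>Positivity of the parts: a further part exists exactly if letters
    remain.\<close>
  have \<alpha>: "\<alpha> \<noteq> [] \<longleftrightarrow> a < length w" using "2.prems" by (cases \<alpha>) auto
  have mem: "k \<in> partial_sums (a # \<alpha>) \<longleftrightarrow> a < length w \<and> (k = a \<or> a \<le> k \<and> k - a \<in> partial_sums \<alpha>)" for k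
    unfolding partial_sums_Cons using \<alpha> by (auto simp: image_iff) (metis le_add_diff_inverse)
  show ?case
  proof (intro iffI allI impI)
    fix i
    assume s: "\<forall>s\<in>set (segments (a # \<alpha>) w). sorted s"
      and i: "Suc i < length w" "w ! Suc i < w ! i"
    consider "Suc i < a" | "Suc i = a" | j where "i = a + j"
      by (metis Suc_lessI le_add_diff_inverse not_less_eq not_le)
    then show "Suc i \<in> partial_sums (a # \<alpha>)"
    proof cases
      case 1
      then show ?thesis using s i first by auto
    next
      case 2
      then show ?thesis using i by (simp add: mem)
    next
      case 3
      then show ?thesis using s i IH by (auto simp: mem)
    qed
  next
    assume D: "\<forall>i. Suc i < length w \<longrightarrow> w ! Suc i < w ! i \<longrightarrow> Suc i \<in> partial_sums (a # \<alpha>)"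
    have "sorted (take a w)"
      unfolding first
    proof (intro allI impI notI)
      fix i assume i: "Suc i < a" "w ! Suc i < w ! i"
      then have "Suc i \<in> partial_sums (a # \<alpha>)" using D a(2) by simp
      with i(1) show False by (simp add: mem)
    qed
    moreover have "Suc i \<in> partial_sums \<alpha>" if "a + Suc i < length w" "w ! (a + Suc i) < w ! (a + i)" for i
      using D[rule_format, of "a + i"] that by (simp add: mem)
    ultimately show "\<forall>s\<in>set (segments (a # \<alpha>) w). sorted s"
      using IH by auto
  qed
qed

section \<open>Permutations in one-line notation\<close>

definition word :: "nat \<Rightarrow> (nat \<Rightarrow> nat) \<Rightarrow> nat list" where
  "word n w = map w [1..<Suc n]"

lemma length_word [simp]: "length (word n w) = n"
  by (simp add: word_def)

lemma word_nth: "i < n \<Longrightarrow> word n w ! i = w (Suc i)"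
  by (simp add: word_def nth_append del: upt_Suc)

lemma word_comp: "word n (y \<circ> v) = map y (word n v)"
  by (simp add: word_def)

lemma word_in_words:
  assumes "w permutes {1..n}"
  shows "word n w \<in> words {1..n}"
proof -
  have "set [1..<Suc n] = {1..n}" by auto
  then show ?thesis
    using permutes_image[OF assms] permutes_inj_on[OF assms]
    by (simp add: words_def word_def distinct_map del: upt_Suc)
qed

lemma word_inj:
  assumes "v permutes {1..n}" "w permutes {1..n}" "word n v = word n w"
  shows "v = w"
proof
  fix i
  show "v i = w i"
  proof (cases "i \<in> {1..n}")
    case True
    then have "i - 1 < n" "Suc (i - 1) = i" by auto
    then show ?thesis
      using word_nth[of "i - 1" n v] word_nth[of "i - 1" n w] assms(3) by simp
  next
    case False
    then show ?thesis using assms by (simp add: permutes_not_in)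
  qed
qed

lemma words_obtain:
  assumes "C \<in> words {1..n}"
  obtains w where "w permutes {1..n}" "word n w = C"
proof -
  have C: "distinct C" "set C = {1..n}" using assms by (auto simp: words_def)
  then have len: "length C = n" using distinct_card[of C] by simp
  define w where "w i = (if i \<in> {1..n} then C ! (i - 1) else i)" for i
  have word: "word n w = C"
    by (rule nth_equalityI) (auto simp: len word_nth w_def)
  have "w ` {1..n} = set (word n w)" by (auto simp: word_def)
  then have "w ` {1..n} = {1..n}" by (simp add: word C)
  moreover from this have "inj_on w {1..n}" by (intro eq_card_imp_inj_on) auto
  ultimately have "w permutes {1..n}"
    by (intro bij_imp_permutes) (auto simp: bij_betw_def w_def)
  with word show ?thesis by (rule that[rotated])
qed

lemma w0_permutes: "w0 n permutes {1..n}"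
proof (rule bij_imp_permutes)
  show "bij_betw (w0 n) {1..n} {1..n}"
    by (rule bij_betwI[where g = "w0 n"]) (auto simp: w0_def)
qed (auto simp: w0_def)

text \<open>Right multiplication by \<open>w0 n\<close> reads the positions backwards.\<close>

lemma rev_word: "rev (word n z) = word n (z \<circ> w0 n)"
  by (rule nth_equalityI) (auto simp: rev_nth word_nth w0_def Suc_diff_Suc)

lemma segments_faces:
  assumes \<alpha>: "composition_of n \<alpha>" and C: "C \<in> words {1..n}"
  shows "map set (segments \<alpha> C) \<in> faces_of_type n \<alpha>"
proof -
  have "length C = n" using C distinct_card[of C] by (simp add: words_def)
  then have len: "length C = sum_list \<alpha>" using \<alpha> by (simp add: composition_of_def)
  note concat = concat_segments[OF len] and lens = map_length_segments[OF len]
  have d: "distinct (concat (segments \<alpha> C))" using C by (simp add: concat words_def)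
  then have ds: "distinct s" if "s \<in> set (segments \<alpha> C)" for s
    using that by (simp add: distinct_concat_iff)
  have "map card (map set (segments \<alpha> C)) = map length (segments \<alpha> C)"
    using ds by (auto simp: distinct_card)
  then have type: "comp_type (map set (segments \<alpha> C)) = \<alpha>"
    by (simp add: comp_type_def lens)
  have "s \<noteq> []" if "s \<in> set (segments \<alpha> C)" for s
  proof -
    have "length s \<in> set \<alpha>" using that lens by (metis image_eqI list.set_map)
    then show ?thesis using \<alpha> by (auto simp: composition_of_def)
  qed
  then have "{} \<notin> set (map set (segments \<alpha> C))" by auto
  moreover have "sorted_wrt disjnt (map set Xs)" if "distinct (concat Xs)" for Xs :: "nat list list"
    using that by (induction Xs) (auto simp: disjnt_def)
  then have "sorted_wrt disjnt (map set (segments \<alpha> C))" using d by blast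
  moreover have "\<Union> (set (map set (segments \<alpha> C))) = {1..n}"
  proof -
    have "\<Union> (set (map set (segments \<alpha> C))) = set (concat (segments \<alpha> C))" by simp
    then show ?thesis using C by (simp only: concat) (simp add: words_def)
  qed
  ultimately show ?thesis
    using type by (simp add: faces_of_type_def faces_def)
qed

text \<open>The letter \<open>y i\<close> stands at position \<open>i\<close>, so the selected
  letters appear by increasing position, which is the order of \<open>s\<close>.\<close>

lemma filter_word:
  assumes "y permutes {1..n}" "sorted s" "distinct s" "set s \<subseteq> {1..n}"
  shows "filter (\<lambda>x. x \<in> y ` set s) (word n y) = map y s"
proof -
  have "filter (\<lambda>x. x \<in> y ` set s) (word n y) = map y (filter (\<lambda>x. x \<in> set s) [1..<Suc n])"
    using permutes_inj[OF assms(1)]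
    by (simp add: word_def filter_map comp_def inj_image_mem_iff del: upt_Suc)
  also have "filter (\<lambda>x. x \<in> set s) [1..<Suc n] = s"
    using assms by (intro sorted_distinct_set_unique) (auto simp: sorted_wrt_filter simp del: upt_Suc)
  finally show ?thesis .
qed

lemma Des_subset_iff:
  assumes "composition_of n \<alpha>"
  shows "Des n v \<subseteq> partial_sums \<alpha> \<longleftrightarrow> (\<forall>s\<in>set (segments \<alpha> (word n v)). sorted s)"
proof -
  have "(\<forall>s\<in>set (segments \<alpha> (word n v)). sorted s) \<longleftrightarrow>
    (\<forall>i. Suc i < n \<longrightarrow> v (Suc (Suc i)) < v (Suc i) \<longrightarrow> Suc i \<in> partial_sums \<alpha>)"
    using assms by (subst sorted_segments_iff) (auto simp: composition_of_def word_nth)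
  also have "\<dots> \<longleftrightarrow> (\<forall>j\<in>{1..<n}. v (j + 1) < v j \<longrightarrow> j \<in> partial_sums \<alpha>)"
  proof safe
    fix j assume *: "\<forall>i. Suc i < n \<longrightarrow> v (Suc (Suc i)) < v (Suc i) \<longrightarrow> Suc i \<in> partial_sums \<alpha>"
      "j \<in> {1..<n}" "v (j + 1) < v j"
    then show "j \<in> partial_sums \<alpha>" by (cases j) auto
  qed auto
  also have "\<dots> \<longleftrightarrow> Des n v \<subseteq> partial_sums \<alpha>" by (auto simp: Des_def)
  finally show ?thesis by simp
qed

text \<open>Bidigare's theorem: right multiplication by \<open>B_elem n \<alpha>\<close> is the left action of the faces
  of type \<open>\<alpha>\<close> on words.\<close>

lemma sum_descent_class:
  assumes \<alpha>: "composition_of n \<alpha>" and y: "y permutes {1..n}"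
  shows "(\<Sum>v | v permutes {1..n} \<and> Des n v \<subseteq> partial_sums \<alpha>. f (word n (y \<circ> v))) =
    (\<Sum>G\<in>faces_of_type n \<alpha>. f (face_act G (word n y)))"
proof -
  let ?D = "{v. v permutes {1..n} \<and> Des n v \<subseteq> partial_sums \<alpha>}"
  \<comment> \<open>The blocks are the sets of values of \<open>y \<circ> v\<close> on consecutive
    runs of positions of lengths \<open>\<alpha>\<close>.\<close>
  define \<phi> where "\<phi> v = map set (segments \<alpha> (word n (y \<circ> v)))" for v
  have act: "face_act (\<phi> v) (word n y) = word n (y \<circ> v)" if v: "v \<in> ?D" for v
  proof -
    have len: "length (word n v) = sum_list \<alpha>" using \<alpha> by (simp add: composition_of_def)
    have w: "distinct (concat (segments \<alpha> (word n v)))" "set (concat (segments \<alpha> (word n v))) = {1..n}"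
      unfolding concat_segments[OF len] using v word_in_words[of v n] by (auto simp: words_def)
    have "filter (\<lambda>x. x \<in> y ` set s) (word n y) = map y s" if s: "s \<in> set (segments \<alpha> (word n v))" for s
    proof (rule filter_word[OF y])
      show "sorted s" using v s Des_subset_iff[OF \<alpha>] by blast
      show "distinct s" using w(1) s by (simp add: distinct_concat_iff)
      show "set s \<subseteq> {1..n}" unfolding w(2)[symmetric] using s by auto
    qed
    then have "map (\<lambda>S. filter (\<lambda>x. x \<in> S) (word n y)) (\<phi> v) = map (map y) (segments \<alpha> (word n v))"
      by (simp add: \<phi>_def word_comp segments_map)
    then have "face_act (\<phi> v) (word n y) = map y (concat (segments \<alpha> (word n v)))"
      by (simp add: face_act_def map_concat)
    then show ?thesis by (simp only: concat_segments[OF len] word_comp)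
  qed
  have "bij_betw \<phi> ?D (faces_of_type n \<alpha>)"
  proof (rule bij_betw_imageI)
    show "inj_on \<phi> ?D"
    proof (rule inj_onI)
      fix u v assume uv: "u \<in> ?D" "v \<in> ?D" "\<phi> u = \<phi> v"
      \<comment> \<open>By \<open>act\<close>, the face determines the word of
        \<open>y \<circ> v\<close>, hence \<open>v\<close>.\<close>
      then have "word n (y \<circ> u) = word n (y \<circ> v)" using act by metis
      then have "y \<circ> u = y \<circ> v"
        using uv y by (intro word_inj[of _ n]) (auto intro: permutes_compose)
      then show "u = v"
        using permutes_inj[OF y] by (metis fun.inj_map inj_eq)
    qed
    show "\<phi> ` ?D = faces_of_type n \<alpha>"
    proof
      show "\<phi> ` ?D \<subseteq> faces_of_type n \<alpha>"
        unfolding \<phi>_def using y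
        by (auto intro!: segments_faces[OF \<alpha>] word_in_words permutes_compose)
    next
      show "faces_of_type n \<alpha> \<subseteq> \<phi> ` ?D"
      proof
        fix G assume G: "G \<in> faces_of_type n \<alpha>"
        then have GF: "G \<in> faces {1..n}" and type: "map card G = \<alpha>"
          by (auto simp: faces_of_type_def comp_type_def)
        have yw: "distinct (word n y)" "set (word n y) = {1..n}"
          using word_in_words[OF y] by (auto simp: words_def)
        \<comment> \<open>For surjectivity, let \<open>G\<close> act on \<open>y\<close> and read
          the result as a permutation \<open>y \<circ> v\<close>.\<close>
        obtain x where x: "x permutes {1..n}" "word n x = face_act G (word n y)"
          using face_act_in_words[OF GF word_in_words[OF y]] by (rule words_obtain)
        define v where "v = inv' y \<circ> x"
        have yv: "y \<circ> v = x" using permutes_inverses(1)[OF y] by (auto simp: v_def)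
        define Xs where "Xs = map (\<lambda>S. filter (\<lambda>x. x \<in> S) (word n y)) G"
        have setS: "set (filter (\<lambda>x. x \<in> S) (word n y)) = S" if "S \<in> set G" for S
          using GF that yw(2) by (auto simp: faces_def)
        have "length (filter (\<lambda>x. x \<in> S) (word n y)) = card S" if "S \<in> set G" for S
          using distinct_card[OF distinct_filter[OF yw(1)]] setS[OF that] by metis
        then have "map length Xs = \<alpha>"
          unfolding type[symmetric] by (simp add: Xs_def)
        then have seg: "segments \<alpha> (word n x) = Xs"
          using segments_concat[of Xs] by (simp add: x(2) face_act_def Xs_def)
        have "\<phi> v = G"
          using setS by (auto simp: \<phi>_def yv seg Xs_def intro!: map_idI)
        moreover have "v permutes {1..n}"
          unfolding v_def by (rule permutes_compose[OF x(1) permutes_inv[OF y]])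
        moreover have "sorted s" if s: "s \<in> set (segments \<alpha> (word n v))" for s
        proof -
          have "segments \<alpha> (word n v) = map (map (inv' y)) Xs"
            by (simp add: v_def word_comp segments_map seg)
          then obtain S where "s = map (inv' y) (filter (\<lambda>x. x \<in> S) (word n y))"
            using s by (auto simp: Xs_def)
          \<comment> \<open>A piece of \<open>v\<close> lists in increasing order the positions of
            the letters of \<open>y\<close> in one block, so \<open>v\<close> has no descent inside
            it.\<close>
          then have "s = filter (\<lambda>i. y i \<in> S) [1..<Suc n]"
            using permutes_inverses(2)[OF y] by (simp add: word_def filter_map comp_def del: upt_Suc)
          then show ?thesis by (simp add: sorted_wrt_filter del: upt_Suc)
        qed
        ultimately show "G \<in> \<phi> ` ?D"
          using Des_subset_iff[OF \<alpha>] by blast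
      qed
    qed
  qed
  then have "(\<Sum>G\<in>faces_of_type n \<alpha>. f (face_act G (word n y))) =
      (\<Sum>v\<in>?D. f (face_act (\<phi> v) (word n y)))"
    by (rule sum.reindex_bij_betw[symmetric])
  then show ?thesis using act by simp
qed

section \<open>The group algebra\<close>

declare One_nat_def [simp del]

text \<open>Gives access to the rules for \<open>finsum\<close>, which occurs in
  \<open>B_elem\<close> and \<open>poly_eval\<close>.\<close>

lemma abelian_monoid_group_algebra:
  "abelian_monoid (group_algebra G :: ('k::field, 'g \<Rightarrow> 'k) module)"
proof (rule abelian_monoidI)
  fix f g :: "'g \<Rightarrow> 'k"
  assume f: "f \<in> carrier (group_algebra G)" and g: "g \<in> carrier (group_algebra G)"
  have "{x. f x + g x \<noteq> 0} \<subseteq> {x. f x \<noteq> 0} \<union> {x. g x \<noteq> 0}" by auto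
  then show "f \<oplus>\<^bsub>group_algebra G\<^esub> g \<in> carrier (group_algebra G)"
    using f g by (auto simp: group_algebra_def intro: finite_subset)
qed (auto simp: group_algebra_def fun_eq_iff algebra_simps)

lemma finsum_group_algebra:
  assumes "finite I" "\<And>i. i \<in> I \<Longrightarrow> f i \<in> carrier (group_algebra G)"
  shows "(\<Oplus>\<^bsub>group_algebra G\<^esub>i\<in>I. f i) = (\<lambda>x. \<Sum>i\<in>I. f i x)"
  using assms
proof (induction I rule: finite_induct)
  case empty
  then show ?case
    by (simp add: abelian_monoid.finsum_empty[OF abelian_monoid_group_algebra])
      (simp add: group_algebra_def)
next
  case (insert i I)
  then show ?case
    by (subst abelian_monoid.finsum_insert[OF abelian_monoid_group_algebra])
      (auto simp: group_algebra_def)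
qed

lemma carrier_group_algebra_sym:
  "f \<in> carrier (group_algebra (sym_group n)) \<longleftrightarrow> (\<forall>x. f x \<noteq> 0 \<longrightarrow> x permutes {1..n})"
proof -
  have "finite {x. f x \<noteq> 0}" if "\<forall>x. f x \<noteq> 0 \<longrightarrow> x permutes {1..n}"
    by (rule finite_subset[OF _ finite_permutations[of "{1..n}"]]) (use that in auto)
  then show ?thesis by (auto simp: group_algebra_def sym_group_def)
qed

lemma mult_group_algebra_sym_closed:
  assumes "f \<in> carrier (group_algebra (sym_group n))" "g \<in> carrier (group_algebra (sym_group n))"
  shows "f \<otimes>\<^bsub>group_algebra (sym_group n)\<^esub> g \<in> carrier (group_algebra (sym_group n))"
  unfolding carrier_group_algebra_sym
proof (intro allI impI)
  fix x assume "(f \<otimes>\<^bsub>group_algebra (sym_group n)\<^esub> g) x \<noteq> 0"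
  then have "(\<Sum>(u, v)\<in>{(u, v). f u \<noteq> 0 \<and> g v \<noteq> 0 \<and> u \<circ> v = x}. f u * g v) \<noteq> 0"
    by (simp add: group_algebra_def sym_group_mult)
  then have "{(u, v). f u \<noteq> 0 \<and> g v \<noteq> 0 \<and> u \<circ> v = x} \<noteq> {}"
    by (metis (no_types, lifting) sum.empty)
  then show "x permutes {1..n}"
    using assms unfolding carrier_group_algebra_sym by (auto intro: permutes_compose)
qed

lemma basis_elem_closed:
  "w permutes {1..n} \<Longrightarrow> basis_elem w \<in> carrier (group_algebra (sym_group n))"
  by (auto simp: carrier_group_algebra_sym basis_elem_def)

lemma one_group_algebra_sym: "\<one>\<^bsub>group_algebra (sym_group n)\<^esub> = basis_elem id"
  by (simp add: group_algebra_def basis_elem_def sym_group_def)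

text \<open>The linear extension of \<open>f\<close> along one-line notation, evaluated at the
  product of \<open>w\<close> and \<open>g\<close> in the group algebra.\<close>

definition pairing :: "nat \<Rightarrow> (nat \<Rightarrow> nat) \<Rightarrow> ((nat \<Rightarrow> nat) \<Rightarrow> 'k::field) \<Rightarrow> (nat list \<Rightarrow> 'k) \<Rightarrow> 'k" where
  "pairing n w g f = (\<Sum>x | x permutes {1..n}. g x * f (word n (w \<circ> x)))"

lemma pairing_mult:
  assumes "g \<in> carrier (group_algebra (sym_group n))" "h \<in> carrier (group_algebra (sym_group n))"
  shows "pairing n w (g \<otimes>\<^bsub>group_algebra (sym_group n)\<^esub> h) f =
    (\<Sum>u | u permutes {1..n}. g u * pairing n (w \<circ> u) h f)"
proof -
  let ?S = "{w. w permutes {1..n}}"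
  let ?t = "\<lambda>(u, v). g u * h v * f (word n (w \<circ> (u \<circ> v)))"
  have "(g \<otimes>\<^bsub>group_algebra (sym_group n)\<^esub> h) x * f (word n (w \<circ> x)) =
      (\<Sum>p\<in>{p \<in> ?S \<times> ?S. (\<lambda>(u, v). u \<circ> v) p = x}. ?t p)" for x
  proof -
    have "(g \<otimes>\<^bsub>group_algebra (sym_group n)\<^esub> h) x =
      (\<Sum>(u, v)\<in>{(u, v). g u \<noteq> 0 \<and> h v \<noteq> 0 \<and> u \<circ> v = x}. g u * h v)"
      by (simp add: group_algebra_def sym_group_mult)
    \<comment> \<open>The sum over the supports becomes one over all pairs of permutations; the
      added terms are 0.\<close>
    also have "\<dots> = (\<Sum>(u, v)\<in>{p \<in> ?S \<times> ?S. (\<lambda>(u, v). u \<circ> v) p = x}. g u * h v)"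
      using assms unfolding carrier_group_algebra_sym
      by (intro sum.mono_neutral_left) (auto simp: finite_permutations)
    finally show ?thesis
      by (auto simp: sum_distrib_right intro!: sum.cong)
  qed
  then have "pairing n w (g \<otimes>\<^bsub>group_algebra (sym_group n)\<^esub> h) f =
      (\<Sum>x\<in>?S. \<Sum>p\<in>{p \<in> ?S \<times> ?S. (\<lambda>(u, v). u \<circ> v) p = x}. ?t p)"
    by (simp add: pairing_def)
  also have "\<dots> = (\<Sum>p\<in>?S \<times> ?S. ?t p)"
    by (rule sum.group) (auto simp: finite_permutations intro: permutes_compose)
  also have "\<dots> = (\<Sum>u\<in>?S. g u * pairing n (w \<circ> u) h f)"
    by (simp add: sum.cartesian_product[symmetric] pairing_def sum_distrib_left mult.assoc comp_assoc)
  finally show ?thesis .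
qed

lemma sum_basis_elem:
  fixes n :: nat
  assumes w: "w permutes {1..n}"
  shows "(\<Sum>u | u permutes {1..n}. basis_elem w u * g u) = g w"
proof -
  have "(\<Sum>u | u permutes {1..n}. basis_elem w u * g u) =
      (\<Sum>u | u permutes {1..n}. if u = w then g u else 0)"
    by (intro sum.cong) (auto simp: basis_elem_def)
  then show ?thesis
    using w by (simp add: sum.delta' finite_permutations)
qed

section \<open>Right multiplication by the element as the transpose of \<open>T\<close>\<close>

context
  fixes n :: nat and \<alpha> :: "nat list" and a :: "(nat \<Rightarrow> nat) \<Rightarrow> 'k::field"
  assumes \<alpha>: "composition_of n \<alpha>"
  defines "a \<equiv> basis_elem (w0 n) \<otimes>\<^bsub>group_algebra (sym_group n)\<^esub> B_elem n \<alpha>"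
begin

lemma B_elem_eq:
  "B_elem n \<alpha> = (\<lambda>x. if x permutes {1..n} \<and> Des n x \<subseteq> partial_sums \<alpha> then 1 else 0 :: 'k)"
proof
  fix x
  have D: "{w \<in> carrier (sym_group n). Des n w \<subseteq> partial_sums \<alpha>} =
    {w. w permutes {1..n} \<and> Des n w \<subseteq> partial_sums \<alpha>}" (is "_ = ?D")
    by (auto simp: sym_group_def)
  have fin: "finite ?D" using finite_permutations[of "{1..n}"] by (auto intro: finite_subset)
  have "B_elem n \<alpha> x = (\<Sum>w\<in>?D. basis_elem w x :: 'k)"
    unfolding B_elem_def D using fin by (subst finsum_group_algebra) (auto intro: basis_elem_closed)
  then show "B_elem n \<alpha> x = (if x permutes {1..n} \<and> Des n x \<subseteq> partial_sums \<alpha> then 1 else 0 :: 'k)"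
    using fin by (simp add: basis_elem_def)
qed

lemma B_elem_closed: "(B_elem n \<alpha> :: _ \<Rightarrow> 'k) \<in> carrier (group_algebra (sym_group n))"
  by (simp add: carrier_group_algebra_sym B_elem_eq)

lemma a_closed: "a \<in> carrier (group_algebra (sym_group n))"
  unfolding a_def
  by (intro mult_group_algebra_sym_closed basis_elem_closed B_elem_closed w0_permutes)

text \<open>The factor \<open>w0 n\<close> reverses the word, and \<open>sum_descent_class\<close>
  turns \<open>B_elem n \<alpha>\<close> into the sum over faces.\<close>

lemma pairing_a:
  assumes "z permutes {1..n}"
  shows "pairing n z a f = step n \<alpha> f (word n z)"
proof -
  have zw: "z \<circ> w0 n permutes {1..n}" using assms by (intro permutes_compose w0_permutes)
  have "pairing n z a f = pairing n (z \<circ> w0 n) (B_elem n \<alpha>) f"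
    unfolding a_def
    by (simp add: pairing_mult basis_elem_closed B_elem_closed w0_permutes sum_basis_elem)
  also have "\<dots> = (\<Sum>v | v permutes {1..n} \<and> Des n v \<subseteq> partial_sums \<alpha>. f (word n (z \<circ> w0 n \<circ> v)))"
    unfolding pairing_def B_elem_eq
    by (rule sum.mono_neutral_cong_right) (auto simp: finite_permutations)
  also have "\<dots> = step n \<alpha> f (word n z)"
    by (simp add: sum_descent_class[OF \<alpha> zw] step_def rev_word word_in_words[OF assms])
  finally show ?thesis .
qed

lemma pow_a_closed: "a [^]\<^bsub>group_algebra (sym_group n)\<^esub> (i :: nat) \<in> carrier (group_algebra (sym_group n))"
  unfolding nat_pow_def
  by (induction i)
    (auto simp: one_group_algebra_sym intro: basis_elem_closed permutes_id mult_group_algebra_sym_closed a_closed)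

text \<open>The last factor of the power is moved to \<open>f\<close>, where it acts as
  \<open>step\<close>.\<close>

lemma pairing_pow_a:
  assumes "w permutes {1..n}"
  shows "pairing n w (a [^]\<^bsub>group_algebra (sym_group n)\<^esub> (i :: nat)) f = (step n \<alpha> ^^ i) f (word n w)"
proof (induction i arbitrary: f)
  case 0
  show ?case
    by (simp add: nat_pow_def one_group_algebra_sym pairing_def sum_basis_elem permutes_id)
next
  case (Suc i)
  let ?p = "a [^]\<^bsub>group_algebra (sym_group n)\<^esub> i"
  have "a [^]\<^bsub>group_algebra (sym_group n)\<^esub> Suc i = ?p \<otimes>\<^bsub>group_algebra (sym_group n)\<^esub> a"
    by (simp add: nat_pow_def)
  then have "pairing n w (a [^]\<^bsub>group_algebra (sym_group n)\<^esub> Suc i) f =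
      (\<Sum>u | u permutes {1..n}. ?p u * pairing n (w \<circ> u) a f)"
    by (simp add: pairing_mult pow_a_closed a_closed)
  also have "\<dots> = pairing n w ?p (step n \<alpha> f)"
    unfolding pairing_def[of n w] using assms
    by (intro sum.cong) (auto simp: pairing_a permutes_compose)
  finally show ?case by (simp add: Suc.IH funpow_swap1)
qed

lemma poly_eval_a: "poly_eval (group_algebra (sym_group n)) q a =
  (\<lambda>x. \<Sum>i\<le>degree q. coeff q i * (a [^]\<^bsub>group_algebra (sym_group n)\<^esub> i) x)"
proof -
  have smult: "c \<odot>\<^bsub>group_algebra (sym_group n)\<^esub> f = (\<lambda>x. c * f x)" for c :: 'k and f
    by (simp add: group_algebra_def)
  show ?thesis
    unfolding poly_eval_def smult using pow_a_closed
    by (subst finsum_group_algebra) (auto simp: carrier_group_algebra_sym)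
qed

lemma pairing_poly_eval:
  assumes "w permutes {1..n}"
  shows "pairing n w (poly_eval (group_algebra (sym_group n)) q a) f = papp (step n \<alpha>) q f (word n w)"
proof -
  have "pairing n w (poly_eval (group_algebra (sym_group n)) q a) f =
    (\<Sum>i\<le>degree q. coeff q i * pairing n w (a [^]\<^bsub>group_algebra (sym_group n)\<^esub> i) f)"
    unfolding pairing_def poly_eval_a sum_distrib_right sum_distrib_left mult.assoc
    by (rule sum.swap)
  then show ?thesis by (simp add: pairing_pow_a[OF assms] papp_def)
qed

text \<open>The pairings of an element of the group algebra with all functions determine it.\<close>

lemma poly_eval_zero_iff:
  "poly_eval (group_algebra (sym_group n)) q a = \<zero>\<^bsub>group_algebra (sym_group n)\<^esub> \<longleftrightarrow>
    (\<forall>f. \<forall>C\<in>words {1..n}. papp (step n \<alpha>) q f C = 0)"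
proof
  assume *: "poly_eval (group_algebra (sym_group n)) q a = \<zero>\<^bsub>group_algebra (sym_group n)\<^esub>"
  show "\<forall>f. \<forall>C\<in>words {1..n}. papp (step n \<alpha>) q f C = 0"
  proof (intro allI ballI)
    fix f C assume "C \<in> words {1..n}"
    then obtain w where w: "w permutes {1..n}" "word n w = C" by (rule words_obtain)
    have "pairing n w (poly_eval (group_algebra (sym_group n)) q a) f = 0"
      unfolding * by (simp add: pairing_def group_algebra_def)
    then show "papp (step n \<alpha>) q f C = 0"
      using pairing_poly_eval[OF w(1)] by (simp add: w(2))
  qed
next
  assume *: "\<forall>f. \<forall>C\<in>words {1..n}. papp (step n \<alpha>) q f C = 0"
  have "poly_eval (group_algebra (sym_group n)) q a x = 0" for x
  proof (cases "x permutes {1..n}")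
    case True
    \<comment> \<open>Pairing with this indicator at the identity reads off the coefficient of
      \<open>x\<close>.\<close>
    define f where "f C = (if C = word n x then 1 else 0 :: 'k)" for C
    have "0 = pairing n id (poly_eval (group_algebra (sym_group n)) q a) f"
      using * word_in_words[OF permutes_id] by (simp add: pairing_poly_eval permutes_id)
    also have "\<dots> = (\<Sum>y | y permutes {1..n}.
        if y = x then poly_eval (group_algebra (sym_group n)) q a y else 0)"
      unfolding pairing_def f_def using True word_inj[of _ n x] by (intro sum.cong) auto
    also have "\<dots> = poly_eval (group_algebra (sym_group n)) q a x"
      using True by (simp add: finite_permutations)
    finally show ?thesis by simp
  next
    case False
    then have "(a [^]\<^bsub>group_algebra (sym_group n)\<^esub> i) x = 0" for i :: nat
      using pow_a_closed unfolding carrier_group_algebra_sym by blast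
    then show ?thesis by (simp add: poly_eval_a)
  qed
  then show "poly_eval (group_algebra (sym_group n)) q a = \<zero>\<^bsub>group_algebra (sym_group n)\<^esub>"
    by (simp add: group_algebra_def fun_eq_iff)
qed

end

text \<open>\<open>step\<close> looks at \<open>f\<close> only on words, which reversal and faces
  preserve; the zeroth power is the reason for the condition on \<open>C\<close>.\<close>

lemma papp_step_cong:
  assumes "\<And>C. C \<in> words {1..n} \<Longrightarrow> f C = g C" "C \<in> words {1..n}"
  shows "papp (step n \<alpha>) q f C = papp (step n \<alpha>) q g C"
proof -
  have "step n \<alpha> f D = step n \<alpha> g D" for D
    using assms(1) unfolding step_def
    by (auto intro!: sum.cong simp: faces_of_type_def face_act_in_words rev_in_words)
  then have "step n \<alpha> f = step n \<alpha> g" by blast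
  then have "(step n \<alpha> ^^ i) f C = (step n \<alpha> ^^ i) g C" for i
    using assms by (cases i) (simp_all add: funpow_swap1)
  then show ?thesis by (simp add: papp_def)
qed

theorem theorem8p1:
  fixes n :: nat and \<alpha> :: "nat list"
  assumes "composition_of n \<alpha>"
  shows "is_minimal_polynomial
           (group_algebra (sym_group n) :: ('k::field_char_0, (nat \<Rightarrow> nat) \<Rightarrow> 'k) module)
           (basis_elem (w0 n) \<otimes>\<^bsub>group_algebra (sym_group n)\<^esub> B_elem n \<alpha>)
           (\<Prod>k \<in> n_tilde n \<alpha> ` set_compositions n. [:- of_int k, 1:])"
proof -
  let ?K = "n_tilde n \<alpha> ` faces {1..n}"
  let ?Q = "root_prod ?K :: 'k poly"
  have K: "finite ?K" by (simp add: finite_faces)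
  have monic: "lead_coeff ?Q = 1"
    by (simp add: root_prod_def lead_coeff_prod)
  have deg: "degree ?Q = card ?K"
    unfolding root_prod_def by (subst degree_prod_eq_sum_degree) auto
  have "papp (step n \<alpha>) ?Q f C = 0" if "C \<in> words {1..n}" for f C
    using papp_step_root_prod_zero[of n \<alpha> f] that
      papp_step_cong[of n f "pull n False (top_face n) f" C \<alpha> ?Q]
    by (simp add: pull_top_face)
  \<comment> \<open>Minimality by counting: in characteristic 0 the elements of \<open>?K\<close>
    are distinct roots of every nonzero annihilating \<open>q\<close>.\<close>
  moreover have "card ?K \<le> degree q"
    if "q \<noteq> 0" and q: "\<forall>f. \<forall>C\<in>words {1..n}. papp (step n \<alpha>) q f C = 0" for q :: "'k poly"
  proof -
    have "of_int ` ?K \<subseteq> {x. poly q x = 0}"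
      using q by (auto intro!: poly_n_tilde_zero)
    then have "card (of_int ` ?K :: 'k set) \<le> card {x. poly q x = 0}"
      by (intro card_mono poly_roots_finite[OF \<open>q \<noteq> 0\<close>])
    also have "\<dots> \<le> degree q" by (rule card_poly_roots_bound[OF \<open>q \<noteq> 0\<close>])
    finally show ?thesis by (simp add: card_image inj_on_def)
  qed
  ultimately have "is_minimal_polynomial (group_algebra (sym_group n))
      (basis_elem (w0 n) \<otimes>\<^bsub>group_algebra (sym_group n)\<^esub> B_elem n \<alpha>) ?Q"
    unfolding is_minimal_polynomial_def poly_eval_zero_iff[OF assms] using monic deg by auto
  then show ?thesis
    unfolding root_prod_def set_compositions_eq_faces .
qed

end
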